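(* The Polish group $G=H_+(\mathbb{T})$ of orientation preserving homeomorphisms of the circle $\mathbb{T}$ (with the compact open topology) has the SUC-fpp (is SUC-extremely amenable) but it is not extremely amenable.
   Context: A compact $G$-space is a (nonempty) compact Hausdorff space with a continuous left action of the topological group $G$. $G$ is extremely amenable if every compact $G$-space has a $G$-fixed point. A compact $G$-space $Y$, with its unique compatible uniformity $\mu_Y$, is SUC if for every $y_0\in Y$ and every $\varepsilon\in\mu_Y$ there is a neighborhood $U$ of $e$ such that $(guy_0,gy_0)\in\varepsilon$ for all $g\in G$, $u\in U$. $G$ has the SUC-fpp (is SUC-extremely amenable) if every compact SUC $G$-space has a $G$-fixed point. *)

theory Defs
  imports "HOL-Analysis.Analysis" "HOL-Algebra.Group_Action"
begin

section \<open>Topological groups\<close>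

locale topological_group = group G for G (structure) +
  fixes T
  assumes topspace_eq_carrier: "topspace T = carrier G"
    and continuous_mult: "continuous_map (prod_topology T T) T (\<lambda>(g, h). g \<otimes> h)"
    and continuous_inv: "continuous_map T T (\<lambda>g. inv g)"

definition Polish_space :: "'a topology \<Rightarrow> bool"
  where "Polish_space X \<longleftrightarrow> separable_space X \<and> completely_metrizable_space X"

definition Polish_group :: "('g, 'm) monoid_scheme \<Rightarrow> 'g topology \<Rightarrow> bool"
  where "Polish_group G T \<longleftrightarrow> topological_group G T \<and> Polish_space T"


section \<open>Uniformities\<close>

definition uniformity_on :: "'a set \<Rightarrow> ('a \<times> 'a) set set \<Rightarrow> bool"
  where "uniformity_on X \<U> \<longleftrightarrow>
    \<U> \<noteq> {} \<and>
    (\<forall>E\<in>\<U>. Id_on X \<subseteq> E \<and> E \<subseteq> X \<times> X) \<and>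
    (\<forall>E\<in>\<U>. \<forall>F. E \<subseteq> F \<and> F \<subseteq> X \<times> X \<longrightarrow> F \<in> \<U>) \<and>
    (\<forall>E\<in>\<U>. \<forall>F\<in>\<U>. E \<inter> F \<in> \<U>) \<and>
    (\<forall>E\<in>\<U>. E\<inverse> \<in> \<U>) \<and>
    (\<forall>E\<in>\<U>. \<exists>D\<in>\<U>. D O D \<subseteq> E)"

definition compatible_uniformity :: "'a topology \<Rightarrow> ('a \<times> 'a) set set \<Rightarrow> bool"
  where "compatible_uniformity Y \<U> \<longleftrightarrow>
    uniformity_on (topspace Y) \<U> \<and>
    (\<forall>U. openin Y U \<longleftrightarrow> U \<subseteq> topspace Y \<and> (\<forall>x\<in>U. \<exists>E\<in>\<U>. E `` {x} \<subseteq> U))"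

text \<open>Only meaningful for compact Hausdorff spaces, where exactly one compatible uniformity exists.\<close>

definition the_uniformity :: "'a topology \<Rightarrow> ('a \<times> 'a) set set"
  where "the_uniformity Y = (THE \<U>. compatible_uniformity Y \<U>)"


section \<open>Compact $G$-spaces and fixed point properties\<close>

text \<open>The action sends \<open>g\<close> to the bijection \<open>\<phi> g\<close> of the space.\<close>

definition compact_G_space ::
    "('g, 'm) monoid_scheme \<Rightarrow> 'g topology \<Rightarrow> 'y topology \<Rightarrow> ('g \<Rightarrow> 'y \<Rightarrow> 'y) \<Rightarrow> bool"
  where "compact_G_space G T Y \<phi> \<longleftrightarrow>
    topspace Y \<noteq> {} \<and> compact_space Y \<and> Hausdorff_space Y \<and>
    group_action G (topspace Y) \<phi> \<and>
    continuous_map (prod_topology T Y) Y (\<lambda>(g, y). \<phi> g y)"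

definition SUC_G_space ::
    "('g, 'm) monoid_scheme \<Rightarrow> 'g topology \<Rightarrow> 'y topology \<Rightarrow> ('g \<Rightarrow> 'y \<Rightarrow> 'y) \<Rightarrow> bool"
  where "SUC_G_space G T Y \<phi> \<longleftrightarrow>
    (\<forall>y\<^sub>0\<in>topspace Y. \<forall>\<epsilon>\<in>the_uniformity Y. \<exists>U. openin T U \<and> \<one>\<^bsub>G\<^esub> \<in> U \<and>
      (\<forall>g\<in>carrier G. \<forall>u\<in>U. (\<phi> (g \<otimes>\<^bsub>G\<^esub> u) y\<^sub>0, \<phi> g y\<^sub>0) \<in> \<epsilon>))"

definition has_fixed_point ::
    "('g, 'm) monoid_scheme \<Rightarrow> 'y topology \<Rightarrow> ('g \<Rightarrow> 'y \<Rightarrow> 'y) \<Rightarrow> bool"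
  where "has_fixed_point G Y \<phi> \<longleftrightarrow> (\<exists>y\<in>topspace Y. \<forall>g\<in>carrier G. \<phi> g y = y)"

text \<open>HOL cannot quantify over types inside a formula, so the next two properties carry the type
  \<open>'y\<close> whose subsets serve as underlying sets of the compact spaces. A group is extremely
  amenable (has the SUC-fpp) iff the property holds for every choice of \<open>'y\<close>; it fails to be so
  iff the property fails for some \<open>'y\<close>.\<close>

definition extremely_amenable ::
    "'y itself \<Rightarrow> ('g, 'm) monoid_scheme \<Rightarrow> 'g topology \<Rightarrow> bool"
  where "extremely_amenable (_ :: 'y itself) G T \<longleftrightarrow>
    (\<forall>(Y :: 'y topology) \<phi>. compact_G_space G T Y \<phi> \<longrightarrow> has_fixed_point G Y \<phi>)"

definition SUC_fpp ::
    "'y itself \<Rightarrow> ('g, 'm) monoid_scheme \<Rightarrow> 'g topology \<Rightarrow> bool"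
  where "SUC_fpp (_ :: 'y itself) G T \<longleftrightarrow>
    (\<forall>(Y :: 'y topology) \<phi>. compact_G_space G T Y \<phi> \<and> SUC_G_space G T Y \<phi>
      \<longrightarrow> has_fixed_point G Y \<phi>)"


section \<open>The group of orientation preserving homeomorphisms of the circle\<close>

text \<open>Continuous maps from \<open>X\<close> to \<open>Y\<close> are represented by functions that are \<^const>\<open>undefined\<close>
  outside \<open>topspace X\<close>, so that equal maps are equal functions.\<close>

definition compact_open_topology :: "'a topology \<Rightarrow> 'b topology \<Rightarrow> ('a \<Rightarrow> 'b) topology"
  where "compact_open_topology X Y = topology_generated_by
    {{f \<in> extensional (topspace X). continuous_map X Y f \<and> f ` K \<subseteq> U} | K U.
      compactin X K \<and> openin Y U}"

abbreviation circle :: "complex set"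
  where "circle \<equiv> sphere 0 1"

text \<open>A circle homeomorphism preserves the orientation iff it has an increasing lift to the
  universal cover \<open>t \<mapsto> cis t\<close>.\<close>

definition orientation_preserving :: "(complex \<Rightarrow> complex) \<Rightarrow> bool"
  where "orientation_preserving f \<longleftrightarrow>
    (\<exists>F :: real \<Rightarrow> real. continuous_on UNIV F \<and> strict_mono F \<and> (\<forall>t. f (cis t) = cis (F t)))"

definition Homeo_plus_circle :: "(complex \<Rightarrow> complex) monoid"
  where "Homeo_plus_circle = (BijGroup circle)
    \<lparr>carrier := {f \<in> Bij circle. homeomorphic_map (top_of_set circle) (top_of_set circle) f \<and>
                                orientation_preserving f}\<rparr>"

definition Homeo_plus_circle_topology :: "(complex \<Rightarrow> complex) topology"
  where "Homeo_plus_circle_topology =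
    subtopology (compact_open_topology (top_of_set circle) (top_of_set circle))
      (carrier Homeo_plus_circle)"

end

theory Submission
  imports Defs
begin

text \<open>Let \<open>Y\<close> be a compact SUC space for \<open>G = H\<^sub>+(T)\<close>. Choose \<open>g\<^sub>n \<in> G\<close> fixing \<open>1\<close> and pushing everything
  except a shrinking arc that ends at \<open>1\<close> towards \<open>1\<close>, and let \<open>y\<close> be a cluster point of \<open>g\<^sub>n y\<^sub>0\<close>.
  If \<open>h\<close> is the identity on an arc starting at \<open>1\<close>, then \<open>u\<^sub>n = g\<^sub>n\<inverse> h g\<^sub>n\<close> tends to the identity, and SUC
  at \<open>y\<^sub>0\<close> shows that \<open>h g\<^sub>n y\<^sub>0 = g\<^sub>n u\<^sub>n y\<^sub>0\<close> is close to \<open>g\<^sub>n y\<^sub>0\<close>; so \<open>h\<close> fixes \<open>y\<close>. Such \<open>h\<close> are dense in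
  the stabilizer of \<open>1\<close>, which therefore fixes \<open>y\<close>. Finally let \<open>k \<in> G\<close> move \<open>1\<close>, and let \<open>u\<close> be a
  rotation so small that \<open>(h u y, h y)\<close> is in a given entourage for all \<open>h\<close>. Some \<open>h\<close> in the stabilizer
  takes \<open>u 1\<close> to \<open>k 1\<close>; then \<open>h y = y\<close> and \<open>h u y = k y\<close>, so \<open>k y\<close> is arbitrarily close to \<open>y\<close>.

  The group is Polish because, inside the complete space of continuous self-maps of the circle, it is
  the set of injective maps of degree one, and degree one is an open condition while injectivity is a
  \<open>G\<^sub>\<delta>\<close> condition. Rotations show that the action on the circle has no fixed point.\<close>

section \<open>The uniformity of a compact Hausdorff space\<close>

text \<open>On a compact Hausdorff space the unique compatible uniformity consists of all
  neighborhoods of the diagonal. This explicit form replaces the definite description in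
  \<open>the_uniformity\<close>.\<close>

definition diagonal_nhds :: "'a topology \<Rightarrow> ('a \<times> 'a) set set"
  where "diagonal_nhds Y = {E. E \<subseteq> topspace Y \<times> topspace Y \<and>
    (\<exists>W. openin (prod_topology Y Y) W \<and> Id_on (topspace Y) \<subseteq> W \<and> W \<subseteq> E)}"

lemma diagonal_nhdsI:
  assumes "openin (prod_topology Y Y) W" "Id_on (topspace Y) \<subseteq> W" "W \<subseteq> E"
    "E \<subseteq> topspace Y \<times> topspace Y"
  shows "E \<in> diagonal_nhds Y"
  unfolding diagonal_nhds_def mem_Collect_eq using assms by metis

lemma diagonal_nhdsE:
  assumes "E \<in> diagonal_nhds Y"
  obtains W where "openin (prod_topology Y Y) W" "Id_on (topspace Y) \<subseteq> W" "W \<subseteq> E"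
    "E \<subseteq> topspace Y \<times> topspace Y"
  using assms unfolding diagonal_nhds_def mem_Collect_eq by metis

text \<open>Compactness with the cover indexed by points, so that other data chosen at
  \<open>x\<close> stay attached to the finitely many points that are kept.\<close>

lemma compact_space_pointwise_cover:
  assumes "compact_space Y" and A: "\<And>x. x \<in> topspace Y \<Longrightarrow> openin Y (A x) \<and> x \<in> A x"
  obtains P where "finite P" "P \<subseteq> topspace Y" "topspace Y \<subseteq> \<Union>(A ` P)"
proof -
  have "\<forall>U\<in>A ` topspace Y. openin Y U" "topspace Y \<subseteq> \<Union>(A ` topspace Y)"
    using A by auto
  then obtain \<F> where "finite \<F>" "\<F> \<subseteq> A ` topspace Y" "topspace Y \<subseteq> \<Union>\<F>"
    using assms(1) unfolding compact_space_alt by meson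
  then show thesis using that by (metis finite_subset_image)
qed

text \<open>Regularity puts a closed set \<open>C x\<close> between two neighborhoods of each point
  \<open>x\<close>, the larger of which, \<open>V x\<close>, has its square inside \<open>W\<close>.
  Finitely many of the smaller ones cover the space.\<close>

lemma diagonal_nhds_halving:
  assumes cpt: "compact_space Y" and H: "Hausdorff_space Y"
    and W: "openin (prod_topology Y Y) W" "Id_on (topspace Y) \<subseteq> W"
  obtains D where "openin (prod_topology Y Y) D" "Id_on (topspace Y) \<subseteq> D" "D O D \<subseteq> W"
proof -
  have reg: "regular_space Y"
    using cpt H by (rule compact_Hausdorff_imp_regular_space)
  have "\<exists>U V C. openin Y U \<and> openin Y V \<and> closedin Y C \<and> x \<in> U \<and> U \<subseteq> C \<and> C \<subseteq> V \<and> V \<times> V \<subseteq> W"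
    if x: "x \<in> topspace Y" for x
  proof -
    have "(x, x) \<in> W" using W x by auto
    then obtain A B where AB: "openin Y A" "openin Y B" "x \<in> A" "x \<in> B" "A \<times> B \<subseteq> W"
      using W unfolding openin_prod_topology_alt by meson
    define V where "V = A \<inter> B"
    have V: "openin Y V" "x \<in> V" "V \<times> V \<subseteq> W"
      using AB by (auto simp: V_def)
    have "closedin Y (topspace Y - V)" "x \<in> topspace Y - (topspace Y - V)"
      using V x by auto
    then obtain U U' where U: "openin Y U" "openin Y U'" "x \<in> U" "topspace Y - V \<subseteq> U'" "disjnt U U'"
      using reg unfolding regular_space_def by meson
    have "U \<subseteq> topspace Y - U'"
      using U openin_subset by (fastforce simp: disjnt_iff)
    moreover have "topspace Y - U' \<subseteq> V" using U by auto
    moreover have "closedin Y (topspace Y - U')" using U by auto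
    ultimately show ?thesis using U V by meson
  qed
  then obtain U V C where UVC: "\<And>x. x \<in> topspace Y \<Longrightarrow> openin Y (U x) \<and> openin Y (V x) \<and>
      closedin Y (C x) \<and> x \<in> U x \<and> U x \<subseteq> C x \<and> C x \<subseteq> V x \<and> V x \<times> V x \<subseteq> W"
    by metis
  obtain P where P: "finite P" "P \<subseteq> topspace Y" "topspace Y \<subseteq> \<Union>(U ` P)"
    using compact_space_pointwise_cover[OF cpt, of U] UVC by metis
  \<comment> \<open>For each \<open>x\<close> in \<open>P\<close>, a pair in \<open>D\<close> lies
    wholly in \<open>V x\<close> or wholly outside \<open>C x\<close>. If the middle point of two
    such pairs lies in \<open>U x\<close>, hence in \<open>C x\<close>, the second case is excluded
    for both pairs, so the outer points lie in \<open>V x\<close>.\<close>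
  define D where "D = (topspace Y \<times> topspace Y) \<inter>
    (\<Inter>x\<in>P. V x \<times> V x \<union> (topspace Y - C x) \<times> (topspace Y - C x))"
  show thesis
  proof
    have T: "openin (prod_topology Y Y) (topspace Y \<times> topspace Y)"
      by (simp add: openin_prod_Times_iff)
    have "openin (prod_topology Y Y) (V x \<times> V x \<union> (topspace Y - C x) \<times> (topspace Y - C x))"
      if "x \<in> P" for x
      using UVC[of x] that P by (intro openin_Un) (simp_all add: openin_prod_Times_iff openin_diff subset_iff)
    then show "openin (prod_topology Y Y) D"
      unfolding D_def using P T by (cases "P = {}") (auto intro!: openin_INT openin_Int)
    show "Id_on (topspace Y) \<subseteq> D"
      using UVC P by (auto simp: D_def)
    show "D O D \<subseteq> W"
    proof clarify
      fix p q r assume pq: "(p, q) \<in> D" "(q, r) \<in> D"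
      then have "q \<in> topspace Y" by (auto simp: D_def)
      then obtain x where x: "x \<in> P" "q \<in> U x" using P by auto
      then have "q \<in> C x" using UVC P by blast
      with pq x have "p \<in> V x" "r \<in> V x" by (auto simp: D_def)
      then show "(p, r) \<in> W" using UVC x P by blast
    qed
  qed
qed

lemma compatible_uniformity_diagonal_nhds:
  assumes cpt: "compact_space Y" and H: "Hausdorff_space Y"
  shows "compatible_uniformity Y (diagonal_nhds Y)"
proof -
  let ?T = "topspace Y"
  have "openin (prod_topology Y Y) (?T \<times> ?T)" "Id_on ?T \<subseteq> ?T \<times> ?T"
    by (simp_all add: openin_prod_Times_iff Id_on_subset_Times)
  then have "?T \<times> ?T \<in> diagonal_nhds Y"
    by (rule diagonal_nhdsI) simp_all
  moreover have "E\<inverse> \<in> diagonal_nhds Y" if E: "E \<in> diagonal_nhds Y" for E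
  proof -
    obtain W where W: "openin (prod_topology Y Y) W" "Id_on ?T \<subseteq> W" "W \<subseteq> E" "E \<subseteq> ?T \<times> ?T"
      by (rule diagonal_nhdsE[OF E])
    have "openin (prod_topology Y Y) (W\<inverse>)"
      unfolding openin_prod_topology_alt
    proof (intro allI impI)
      fix x y assume "(x, y) \<in> W\<inverse>"
      then obtain A B where AB: "openin Y A" "openin Y B" "y \<in> A" "x \<in> B" "A \<times> B \<subseteq> W"
        using W(1) unfolding openin_prod_topology_alt by (meson converseD)
      then have "B \<times> A \<subseteq> W\<inverse>" by (simp add: subset_iff)
      with AB show "\<exists>U V. openin Y U \<and> openin Y V \<and> x \<in> U \<and> y \<in> V \<and> U \<times> V \<subseteq> W\<inverse>"
        by metis
    qed
    moreover have "Id_on ?T \<subseteq> W\<inverse>" "W\<inverse> \<subseteq> E\<inverse>" "E\<inverse> \<subseteq> ?T \<times> ?T"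
      using W(2-4) by (simp_all add: subset_iff Id_on_iff)
    ultimately show ?thesis by (rule diagonal_nhdsI)
  qed
  moreover have "\<exists>D\<in>diagonal_nhds Y. D O D \<subseteq> E" if E: "E \<in> diagonal_nhds Y" for E
  proof -
    obtain W where W: "openin (prod_topology Y Y) W" "Id_on ?T \<subseteq> W" "W \<subseteq> E"
      by (rule diagonal_nhdsE[OF E])
    obtain D where D: "openin (prod_topology Y Y) D" "Id_on ?T \<subseteq> D" "D O D \<subseteq> W"
      using diagonal_nhds_halving[OF cpt H W(1,2)] .
    then have "D \<in> diagonal_nhds Y"
      using openin_subset[OF D(1)] by (intro diagonal_nhdsI[of Y D]) simp_all
    with D(3) W(3) show ?thesis by (metis subset_trans)
  qed
  moreover have "E \<inter> F \<in> diagonal_nhds Y" if EF: "E \<in> diagonal_nhds Y" "F \<in> diagonal_nhds Y" for E F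
  proof -
    obtain W where W: "openin (prod_topology Y Y) W" "Id_on ?T \<subseteq> W" "W \<subseteq> E" "E \<subseteq> ?T \<times> ?T"
      by (rule diagonal_nhdsE[OF EF(1)])
    obtain W' where W': "openin (prod_topology Y Y) W'" "Id_on ?T \<subseteq> W'" "W' \<subseteq> F"
      by (rule diagonal_nhdsE[OF EF(2)])
    show ?thesis
      by (rule diagonal_nhdsI[of Y "W \<inter> W'"]) (use W W' in \<open>simp_all add: openin_Int le_infI1 le_infI2\<close>)
  qed
  moreover have "Id_on ?T \<subseteq> E \<and> E \<subseteq> ?T \<times> ?T" if "E \<in> diagonal_nhds Y" for E
    using that by (metis diagonal_nhdsE subset_trans)
  moreover have "F \<in> diagonal_nhds Y" if "E \<in> diagonal_nhds Y" "E \<subseteq> F \<and> F \<subseteq> ?T \<times> ?T" for E F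
    by (rule diagonal_nhdsE[OF that(1)], rule diagonal_nhdsI) (use that(2) in auto)
  ultimately have unif: "uniformity_on ?T (diagonal_nhds Y)"
    unfolding uniformity_on_def by (intro conjI ballI allI impI) (metis empty_iff)+
  have "openin Y U \<longleftrightarrow> U \<subseteq> ?T \<and> (\<forall>x\<in>U. \<exists>E\<in>diagonal_nhds Y. E `` {x} \<subseteq> U)" for U
  proof (intro iffI conjI ballI)
    assume U: "openin Y U"
    then show "U \<subseteq> ?T" by (rule openin_subset)
    fix x assume x: "x \<in> U"
    \<comment> \<open>The slice of \<open>W\<close> at \<open>x\<close> is exactly \<open>U\<close>,
      while the second piece covers the diagonal away from \<open>x\<close>. It is open because
      points are closed.\<close>
    define W where "W = U \<times> U \<union> (?T - {x}) \<times> ?T"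
    have "closedin Y {x}"
      using H x \<open>U \<subseteq> ?T\<close> by (simp add: closedin_Hausdorff_sing_eq subset_iff)
    then have "openin (prod_topology Y Y) W"
      unfolding W_def using U by (intro openin_Un) (auto simp: openin_prod_Times_iff)
    moreover have "Id_on ?T \<subseteq> W" using x by (auto simp: W_def)
    ultimately have "W \<in> diagonal_nhds Y"
      using openin_subset[of "prod_topology Y Y" W] by (intro diagonal_nhdsI[of Y W]) simp_all
    moreover have "W `` {x} \<subseteq> U" by (auto simp: W_def)
    ultimately show "\<exists>E\<in>diagonal_nhds Y. E `` {x} \<subseteq> U" by blast
  next
    assume *: "U \<subseteq> ?T \<and> (\<forall>x\<in>U. \<exists>E\<in>diagonal_nhds Y. E `` {x} \<subseteq> U)"
    show "openin Y U"
    proof (subst openin_subopen, intro ballI)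
      fix x assume x: "x \<in> U"
      then obtain E W where E: "E `` {x} \<subseteq> U" "openin (prod_topology Y Y) W" "Id_on ?T \<subseteq> W" "W \<subseteq> E"
        using * by (metis diagonal_nhdsE)
      then have "(x, x) \<in> W" using x * by auto
      then obtain A B where "openin Y A" "openin Y B" "x \<in> A" "x \<in> B" "A \<times> B \<subseteq> W"
        using E(2) unfolding openin_prod_topology_alt by meson
      then show "\<exists>T. openin Y T \<and> x \<in> T \<and> T \<subseteq> U"
        using E by (intro exI[of _ B]) blast
    qed
  qed
  with unif show ?thesis unfolding compatible_uniformity_def by blast
qed

text \<open>The slice of \<open>E\<close> at \<open>x\<close> need not be open. Its interior
  consists of the points with some whole slice inside it, and halving an entourage shows that this
  set is open.\<close>

lemma compatible_uniformity_nhd: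
  assumes U: "compatible_uniformity Y \<U>" and E: "E \<in> \<U>" and x: "x \<in> topspace Y"
  obtains A where "openin Y A" "x \<in> A" "A \<subseteq> E `` {x}"
proof -
  have uni: "uniformity_on (topspace Y) \<U>"
    and op: "\<And>U. openin Y U \<longleftrightarrow> U \<subseteq> topspace Y \<and> (\<forall>x\<in>U. \<exists>E\<in>\<U>. E `` {x} \<subseteq> U)"
    using U by (auto simp: compatible_uniformity_def)
  define A where "A = {z \<in> topspace Y. \<exists>F\<in>\<U>. F `` {z} \<subseteq> E `` {x}}"
  have "openin Y A"
    unfolding op
  proof (intro conjI ballI)
    show "A \<subseteq> topspace Y" by (auto simp: A_def)
    fix z assume "z \<in> A"
    then obtain F where F: "F \<in> \<U>" "F `` {z} \<subseteq> E `` {x}" unfolding A_def by blast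
    then obtain D where D: "D \<in> \<U>" "D O D \<subseteq> F" using uni unfolding uniformity_on_def by metis
    have "D `` {z} \<subseteq> A"
    proof
      fix w assume w: "w \<in> D `` {z}"
      then have "w \<in> topspace Y" using D uni unfolding uniformity_on_def by blast
      moreover have "D `` {w} \<subseteq> E `` {x}" using w D F by blast
      ultimately show "w \<in> A" using D by (auto simp: A_def)
    qed
    then show "\<exists>E\<in>\<U>. E `` {z} \<subseteq> A" using D by blast
  qed
  moreover have "x \<in> A" using x E by (auto simp: A_def)
  moreover have "A \<subseteq> E `` {x}"
  proof
    fix z assume "z \<in> A"
    then obtain F where "F \<in> \<U>" "F `` {z} \<subseteq> E `` {x}" "z \<in> topspace Y" unfolding A_def by blast
    moreover have "(z, z) \<in> F" using calculation uni unfolding uniformity_on_def by blast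
    ultimately show "z \<in> E `` {x}" by blast
  qed
  ultimately show thesis by (rule that)
qed

text \<open>Halving entourages shows that each of them contains an open neighborhood of the
  diagonal. For the converse, compactness reduces the local choices to a finite intersection of
  entourages.\<close>

lemma compatible_uniformity_unique:
  assumes cpt: "compact_space Y" and U: "compatible_uniformity Y \<U>"
  shows "\<U> = diagonal_nhds Y"
proof
  let ?T = "topspace Y"
  have uni: "uniformity_on ?T \<U>"
    and op: "\<And>U. openin Y U \<longleftrightarrow> U \<subseteq> ?T \<and> (\<forall>x\<in>U. \<exists>E\<in>\<U>. E `` {x} \<subseteq> U)"
    using U by (auto simp: compatible_uniformity_def)
  show "\<U> \<subseteq> diagonal_nhds Y"
  proof
    fix E assume E: "E \<in> \<U>"
    then obtain D where D: "D \<in> \<U>" "D O D \<subseteq> E" using uni unfolding uniformity_on_def by metis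
    \<comment> \<open>Symmetry lets two points that are both close to \<open>x\<close> be compared
      through \<open>x\<close>.\<close>
    define D' where "D' = D \<inter> D\<inverse>"
    have D': "D' \<in> \<U>" using D uni unfolding uniformity_on_def D'_def by blast
    have "\<exists>A. openin Y A \<and> x \<in> A \<and> A \<subseteq> D' `` {x}" if "x \<in> ?T" for x
      using compatible_uniformity_nhd[OF U D' that] by metis
    then obtain A where A: "\<And>x. x \<in> ?T \<Longrightarrow> openin Y (A x) \<and> x \<in> A x \<and> A x \<subseteq> D' `` {x}"
      by metis
    define W where "W = (\<Union>x\<in>?T. A x \<times> A x)"
    have "openin (prod_topology Y Y) W"
      using A by (auto simp: W_def openin_prod_Times_iff)
    moreover have "Id_on ?T \<subseteq> W" using A by (auto simp: W_def)
    moreover have "W \<subseteq> E"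
    proof
      fix p assume "p \<in> W"
      then obtain x where "x \<in> ?T" "fst p \<in> D' `` {x}" "snd p \<in> D' `` {x}"
        using A by (force simp: W_def)
      then show "p \<in> E" using D by (cases p) (auto simp: D'_def)
    qed
    moreover have "E \<subseteq> ?T \<times> ?T" using E uni unfolding uniformity_on_def by blast
    ultimately show "E \<in> diagonal_nhds Y" by (rule diagonal_nhdsI)
  qed
  show "diagonal_nhds Y \<subseteq> \<U>"
  proof
    fix E assume "E \<in> diagonal_nhds Y"
    then obtain W where W: "openin (prod_topology Y Y) W" "Id_on ?T \<subseteq> W" "W \<subseteq> E" and ET: "E \<subseteq> ?T \<times> ?T"
      by (rule diagonal_nhdsE)
    \<comment> \<open>Two steps of \<open>D\<close> starting at \<open>x\<close> must stay in
      \<open>V\<close>: the first leads from \<open>x\<close> to a point of the covering set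
      \<open>A\<close>, the second from there to the other coordinate of a pair in the final
      entourage.\<close>
    have "\<exists>V D A. V \<times> V \<subseteq> W \<and> D \<in> \<U> \<and> (D O D) `` {x} \<subseteq> V \<and> openin Y A \<and> x \<in> A \<and> A \<subseteq> D `` {x}"
      if x: "x \<in> ?T" for x
    proof -
      have "(x, x) \<in> W" using W x by auto
      then obtain A B where AB: "openin Y A" "openin Y B" "x \<in> A" "x \<in> B" "A \<times> B \<subseteq> W"
        using W unfolding openin_prod_topology_alt by meson
      then have "openin Y (A \<inter> B)" by blast
      then obtain F where F: "F \<in> \<U>" "F `` {x} \<subseteq> A \<inter> B" using AB op by (metis IntI)
      obtain D where D: "D \<in> \<U>" "D O D \<subseteq> F" using F uni unfolding uniformity_on_def by metis
      obtain G where "openin Y G" "x \<in> G" "G \<subseteq> D `` {x}"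
        using compatible_uniformity_nhd[OF U D(1) x] .
      moreover have "(D O D) `` {x} \<subseteq> A \<inter> B" using F D by auto
      moreover have "(A \<inter> B) \<times> (A \<inter> B) \<subseteq> W" using AB by auto
      ultimately show ?thesis using D by meson
    qed
    then obtain V D A where VDA: "\<And>x. x \<in> ?T \<Longrightarrow> V x \<times> V x \<subseteq> W \<and> D x \<in> \<U> \<and>
        (D x O D x) `` {x} \<subseteq> V x \<and> openin Y (A x) \<and> x \<in> A x \<and> A x \<subseteq> D x `` {x}"
      by metis
    obtain P where P: "finite P" "P \<subseteq> ?T" "?T \<subseteq> \<Union>(A ` P)"
      using compact_space_pointwise_cover[OF cpt, of A] VDA by metis
    have up: "F \<in> \<U>" if "E \<in> \<U>" "E \<subseteq> F" "F \<subseteq> ?T \<times> ?T" for E F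
      using uni[unfolded uniformity_on_def, THEN conjunct2, THEN conjunct2, THEN conjunct1] that by metis
    have TT: "?T \<times> ?T \<in> \<U>"
    proof -
      obtain E0 where E0: "E0 \<in> \<U>" using uni unfolding uniformity_on_def by (metis ex_in_conv)
      then have "E0 \<subseteq> ?T \<times> ?T" using uni unfolding uniformity_on_def by metis
      with E0 show ?thesis using uni unfolding uniformity_on_def by (metis subset_refl)
    qed
    define B where "B = (?T \<times> ?T) \<inter> (\<Inter>x\<in>P. D x)"
    have "(?T \<times> ?T) \<inter> (\<Inter>x\<in>P. D x) \<in> \<U>"
      using P(1,2)
    proof (induction P rule: finite_induct)
      case empty then show ?case using TT by simp
    next
      case (insert y P)
      have "D y \<inter> ((?T \<times> ?T) \<inter> (\<Inter>x\<in>P. D x)) \<in> \<U>"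
        using insert VDA uni unfolding uniformity_on_def by (metis insert_subset)
      then show ?case by (simp add: Int_left_commute)
    qed
    then have "B \<in> \<U>" by (simp add: B_def)
    moreover have "B \<subseteq> E"
    proof
      fix p assume p: "p \<in> B"
      obtain y z where yz: "p = (y, z)" by (cases p)
      have y: "y \<in> ?T" using p yz by (auto simp: B_def)
      then obtain x where x: "x \<in> P" "y \<in> A x" using P by auto
      have xT: "x \<in> ?T" using x P by auto
      have "(x, y) \<in> D x" using VDA[OF xT] x by blast
      moreover have "(y, y) \<in> D x" using VDA[OF xT] uni y unfolding uniformity_on_def by blast
      moreover have "(y, z) \<in> D x" using p yz x by (auto simp: B_def)
      ultimately have "y \<in> V x" "z \<in> V x" using VDA[OF xT] by auto
      then show "p \<in> E" using VDA[OF xT] W(3) yz by auto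
    qed
    ultimately show "E \<in> \<U>" using up ET by metis
  qed
qed

lemma the_uniformity_eq:
  assumes "compact_space Y" "Hausdorff_space Y"
  shows "the_uniformity Y = diagonal_nhds Y"
  unfolding the_uniformity_def
  using assms compatible_uniformity_diagonal_nhds compatible_uniformity_unique
  by (intro the_equality) blast+

section \<open>The compact-open topology as a metric topology\<close>

text \<open>On a compact domain the compact-open topology is that of uniform convergence. The sets
  open for uniform convergence form a topology, so in one direction only the subbasic sets need
  checking. Conversely, finitely many subbasic constraints force uniform closeness.\<close>

lemma openin_compact_open_metric:
  assumes X: "compact_space X"
  shows "openin (compact_open_topology X (mtopology_of m)) \<U> \<longleftrightarrow>
    \<U> \<subseteq> mspace (cfunspace X m) \<and>
    (\<forall>f\<in>\<U>. \<exists>r>0. \<forall>g\<in>mspace (cfunspace X m).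
      (\<forall>x\<in>topspace X. mdist m (f x) (g x) < r) \<longrightarrow> g \<in> \<U>)"
    (is "openin ?T \<U> \<longleftrightarrow> ?M \<U>")
proof -
  interpret m: Metric_space "mspace m" "mdist m" by (rule Metric_space_mspace_mdist)
  let ?C = "mspace (cfunspace X m)"
  let ?\<B> = "{{f \<in> extensional (topspace X). continuous_map X (mtopology_of m) f \<and> f ` K \<subseteq> U} | K U.
      compactin X K \<and> openin (mtopology_of m) U}"
  have C: "?C = {f \<in> extensional (topspace X). continuous_map X (mtopology_of m) f}"
    using compactin_mspace_cfunspace[of X m] X
    by (auto simp: compact_space_def continuous_map_def mtopology_of_def)
  have T: "?T = topology_generated_by ?\<B>" by (simp add: compact_open_topology_def)
  have fin: "f x \<in> mspace m" if "f \<in> ?C" "x \<in> topspace X" for f x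
    using that by auto
  define L where "L \<V> \<longleftrightarrow> ?M \<V>" for \<V>
  have ist: "istopology L"
    unfolding istopology_def
  proof (intro conjI allI impI)
    fix U V assume UV: "L U" "L V"
    show "L (U \<inter> V)"
      unfolding L_def
    proof (intro conjI ballI)
      fix f assume f: "f \<in> U \<inter> V"
      obtain r s where "r > 0" "s > 0"
        "\<And>g. g \<in> ?C \<Longrightarrow> \<forall>x\<in>topspace X. mdist m (f x) (g x) < r \<Longrightarrow> g \<in> U"
        "\<And>g. g \<in> ?C \<Longrightarrow> \<forall>x\<in>topspace X. mdist m (f x) (g x) < s \<Longrightarrow> g \<in> V"
        using UV f unfolding L_def by (metis IntE)
      then show "\<exists>r>0. \<forall>g\<in>?C. (\<forall>x\<in>topspace X. mdist m (f x) (g x) < r) \<longrightarrow> g \<in> U \<inter> V"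
        by (intro exI[of _ "min r s"]) simp
    qed (use UV[unfolded L_def] in \<open>metis le_infI1\<close>)
  next
    fix \<K> assume \<K>: "\<forall>U\<in>\<K>. L U"
    show "L (\<Union>\<K>)"
      unfolding L_def
    proof (intro conjI ballI)
      fix f assume "f \<in> \<Union>\<K>"
      then obtain U where U: "U \<in> \<K>" "f \<in> U" by blast
      then obtain r where "r > 0"
        "\<And>g. g \<in> ?C \<Longrightarrow> \<forall>x\<in>topspace X. mdist m (f x) (g x) < r \<Longrightarrow> g \<in> U"
        using \<K> unfolding L_def by metis
      with U show "\<exists>r>0. \<forall>g\<in>?C. (\<forall>x\<in>topspace X. mdist m (f x) (g x) < r) \<longrightarrow> g \<in> \<Union>\<K>"
        by (intro exI[of _ r]) (simp del: mspace_cfunspace, metis)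
    next
      show "\<Union>\<K> \<subseteq> ?C"
        using \<K> unfolding L_def by (intro Union_least) (drule (1) bspec, erule conjunct1)
    qed
  qed
  have basis: "L B" if "B \<in> ?\<B>" for B
  proof -
    obtain K U where
      BKU: "B = {f \<in> extensional (topspace X). continuous_map X (mtopology_of m) f \<and> f ` K \<subseteq> U} \<and>
        compactin X K \<and> openin (mtopology_of m) U"
      using \<open>B \<in> ?\<B>\<close> unfolding mem_Collect_eq by (elim exE) (rule that)
    note B = BKU[THEN conjunct1] and K = BKU[THEN conjunct2, THEN conjunct1]
      and U = BKU[THEN conjunct2, THEN conjunct2]
    have "\<exists>r>0. \<forall>g\<in>?C. (\<forall>x\<in>topspace X. mdist m (f x) (g x) < r) \<longrightarrow> g \<in> B" if f: "f \<in> B" for f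
    proof -
      have "compactin m.mtopology (f ` K)"
        using f K by (auto simp: B mtopology_of_def intro: image_compactin)
      \<comment> \<open>The Lebesgue number of the cover of the compact image by the single set
        \<open>U\<close> is one radius valid at all its points.\<close>
      moreover have "f ` K \<subseteq> \<Union>{U}" using f by (auto simp: B)
      ultimately obtain r where r: "r > 0" "\<forall>y\<in>f ` K. m.mball y r \<subseteq> U"
        using m.lebesgue_number[of "f ` K" "{U}"] U by (auto simp: mtopology_of_def)
      have "g \<in> B" if g: "g \<in> ?C" "\<forall>x\<in>topspace X. mdist m (f x) (g x) < r" for g
      proof -
        have "f \<in> ?C" using f unfolding B C by (simp only: mem_Collect_eq)
        have "g x \<in> U" if x: "x \<in> K" for x
        proof -
          have "x \<in> topspace X" using x compactin_subset_topspace[OF K] by blast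
          then have "g x \<in> m.mball (f x) r"
            using g fin[OF \<open>f \<in> ?C\<close>] fin[OF g(1)] by simp
          then show ?thesis using r(2) x by blast
        qed
        then show ?thesis using g(1) unfolding B C by blast
      qed
      with r show ?thesis by blast
    qed
    moreover have "B \<subseteq> ?C" unfolding B C by blast
    ultimately show ?thesis unfolding L_def by metis
  qed
  show ?thesis
  proof
    assume "openin ?T \<U>"
    then have "generate_topology_on ?\<B> \<U>"
      unfolding T openin_topology_generated_by_iff .
    with ist basis have "L \<U>" by (rule generate_topology_on_coarsest)
    then show "?M \<U>" unfolding L_def .
  next
    assume M: "?M \<U>"
    show "openin ?T \<U>"
    proof (subst openin_subopen, intro ballI)
      fix f assume f: "f \<in> \<U>"
      then have fC: "f \<in> ?C" using M[THEN conjunct1] by (rule subsetD[rotated])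
      then have cf: "continuous_map X m.mtopology f" by (auto simp: mtopology_of_def)
      obtain r where r: "r > 0"
        "\<And>g. g \<in> ?C \<Longrightarrow> \<forall>x\<in>topspace X. mdist m (f x) (g x) < r \<Longrightarrow> g \<in> \<U>"
        using M f by metis
      have "m.mtotally_bounded (f ` topspace X)"
        using X cf by (intro m.compactin_imp_mtotally_bounded image_compactin) (auto simp: compact_space_def)
      then obtain P where P: "finite P" "P \<subseteq> f ` topspace X" "f ` topspace X \<subseteq> (\<Union>y\<in>P. m.mball y (r/4))"
        using r unfolding m.mtotally_bounded_def by (meson divide_pos_pos zero_less_numeral)
      \<comment> \<open>Closed balls make \<open>K y\<close> closed, hence compact. If
        \<open>f x\<close> is within \<open>r/4\<close> of the net point \<open>y\<close>, then
        \<open>x\<close> lies in \<open>K y\<close>, and a map in \<open>W y\<close> sends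
        \<open>x\<close> within \<open>r/2\<close> of \<open>y\<close>, so within \<open>r\<close>
        of \<open>f x\<close>.\<close>
      define K where "K y = {x \<in> topspace X. f x \<in> m.mcball y (r/4)}" for y
      define W where "W y = {h \<in> extensional (topspace X). continuous_map X (mtopology_of m) h
          \<and> h ` K y \<subseteq> m.mball y (r/2)}" for y
      define S where "S = ?C \<inter> (\<Inter>y\<in>P. W y)"
      have "closedin X (K y)" for y
        unfolding K_def by (rule closedin_continuous_map_preimage[OF cf]) simp
      then have "compactin X (K y)" for y by (rule closedin_compact_space[OF X])
      moreover have "openin (mtopology_of m) (m.mball y (r/2))" for y
        by (simp add: mtopology_of_def)
      ultimately have "W y \<in> ?\<B>" for y
        unfolding W_def mem_Collect_eq by (intro exI conjI) (rule refl)
      then have W: "openin ?T (W y)" for y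
        unfolding T by (rule topology_generated_by_Basis)
      \<comment> \<open>The constraint with empty \<open>K\<close> and empty \<open>U\<close> is
        vacuous, so the whole function space is a basic open set.\<close>
      have "?C = {f \<in> extensional (topspace X). continuous_map X (mtopology_of m) f \<and> f ` {} \<subseteq> {}}"
        unfolding C by simp
      then have "?C \<in> ?\<B>"
        unfolding mem_Collect_eq using compactin_empty openin_empty by (intro exI conjI)
      then have "openin ?T ?C" unfolding T by (rule topology_generated_by_Basis)
      then have "openin ?T S"
        unfolding S_def using P W by (cases "P = {}") (auto intro!: openin_INT openin_Int)
      moreover have "f \<in> W y" if "y \<in> P" for y
      proof -
        have "f ` K y \<subseteq> m.mball y (r/2)" using r(1) by (auto simp: K_def)
        then show ?thesis using fC unfolding W_def C by simp
      qed
      then have "f \<in> S" using fC by (simp add: S_def del: mspace_cfunspace)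
      moreover have "S \<subseteq> \<U>"
      proof
        fix g assume g: "g \<in> S"
        have "mdist m (f x) (g x) < r" if x: "x \<in> topspace X" for x
        proof -
          obtain y where y: "y \<in> P" "f x \<in> m.mball y (r/4)" using P x by blast
          then have "x \<in> K y" using x by (auto simp: K_def)
          moreover have "g \<in> W y" using g y(1) unfolding S_def by blast
          ultimately have "g x \<in> m.mball y (r/2)" unfolding W_def by blast
          then show ?thesis
            using y m.triangle'[of "f x" y "g x"] r by (auto simp: m.commute)
        qed
        moreover have "g \<in> ?C" using g unfolding S_def by (rule IntD1)
        ultimately show "g \<in> \<U>" using r(2) by simp
      qed
      ultimately show "\<exists>T. openin ?T T \<and> f \<in> T \<and> T \<subseteq> \<U>" by blast
    qed
  qed
qed

text \<open>Metric balls and uniform balls are nested in each other after halving the radius; a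
  strict pointwise bound passes to the supremum only as a non-strict one.\<close>

lemma compact_open_topology_eq_cfunspace:
  assumes X: "compact_space X"
  shows "compact_open_topology X (mtopology_of m) = mtopology_of (cfunspace X m)"
  unfolding topology_eq
proof (intro allI)
  fix \<U>
  interpret C: Metric_space "mspace (cfunspace X m)" "mdist (cfunspace X m)"
    by (rule Metric_space_mspace_mdist)
  let ?C = "mspace (cfunspace X m)"
  have 1: "C.mball f (r/2) \<subseteq> {g \<in> ?C. \<forall>x\<in>topspace X. mdist m (f x) (g x) < r}"
    if "r > 0" "f \<in> ?C" for f r
  proof
    fix g assume "g \<in> C.mball f (r/2)"
    then have "g \<in> ?C" "mdist (cfunspace X m) f g \<le> r/2" by (auto simp del: mspace_cfunspace)
    then show "g \<in> {g \<in> ?C. \<forall>x\<in>topspace X. mdist m (f x) (g x) < r}"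
      using mdist_cfunspace_imp_mdist_le[OF that(2)] that(1)
      by (fastforce simp del: mspace_cfunspace)
  qed
  have 2: "{g \<in> ?C. \<forall>x\<in>topspace X. mdist m (f x) (g x) < r/2} \<subseteq> C.mball f r"
    if "r > 0" "f \<in> ?C" for f r
  proof
    fix g assume g: "g \<in> {g \<in> ?C. \<forall>x\<in>topspace X. mdist m (f x) (g x) < r/2}"
    then have "mdist (cfunspace X m) f g \<le> r/2"
      using that(1) by (intro mdist_cfunspace_le) auto
    then show "g \<in> C.mball f r"
      using g that by (simp del: mspace_cfunspace)
  qed
  have Cop: "openin (mtopology_of (cfunspace X m)) \<U> \<longleftrightarrow>
      \<U> \<subseteq> ?C \<and> (\<forall>f\<in>\<U>. \<exists>r>0. C.mball f r \<subseteq> \<U>)"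
    unfolding mtopology_of_def C.openin_mtopology by (simp only: Ball_def)
  show "openin (compact_open_topology X (mtopology_of m)) \<U> \<longleftrightarrow> openin (mtopology_of (cfunspace X m)) \<U>"
    unfolding openin_compact_open_metric[OF X] Cop
  proof (rule conj_cong[OF refl], rule ball_cong[OF refl])
    fix f assume "\<U> \<subseteq> ?C" "f \<in> \<U>"
    then have f: "f \<in> ?C" by blast
    show "(\<exists>r>0. \<forall>g\<in>?C. (\<forall>x\<in>topspace X. mdist m (f x) (g x) < r) \<longrightarrow> g \<in> \<U>) \<longleftrightarrow>
        (\<exists>r>0. C.mball f r \<subseteq> \<U>)" (is "?l \<longleftrightarrow> ?r")
    proof
      assume ?l
      then obtain r where "r > 0" "{g \<in> ?C. \<forall>x\<in>topspace X. mdist m (f x) (g x) < r} \<subseteq> \<U>" by blast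
      then show ?r using 1[OF _ f] by (meson half_gt_zero subset_trans)
    next
      assume ?r
      then obtain r where "r > 0" "C.mball f r \<subseteq> \<U>" by blast
      then have "r/2 > 0" "{g \<in> ?C. \<forall>x\<in>topspace X. mdist m (f x) (g x) < r/2} \<subseteq> \<U>"
        using 2[OF _ f] by fastforce+
      then show ?l by blast
    qed
  qed
qed

section \<open>Separability from countable codes\<close>

lemma (in Metric_space) separable_space_subtopologyI:
  assumes "S \<subseteq> M" and code: "\<And>r. r > 0 \<Longrightarrow> \<exists>c::'a \<Rightarrow> 'c. countable (c ` S) \<and>
    (\<forall>x\<in>S. \<forall>y\<in>S. c x = c y \<longrightarrow> d x y < r)"
  shows "separable_space (subtopology mtopology S)"
proof -
  have "\<exists>N. countable N \<and> N \<subseteq> S \<and> (\<forall>x\<in>S. \<exists>y\<in>N. d x y < r)" if r: "r > 0" for r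
  proof -
    obtain c :: "'a \<Rightarrow> 'c" where c: "countable (c ` S)" "\<forall>x\<in>S. \<forall>y\<in>S. c x = c y \<longrightarrow> d x y < r"
      using code[OF r] by metis
    \<comment> \<open>One point is taken for each code. The net lies in \<open>S\<close> itself, so
      density in the subspace follows without approximating points of \<open>S\<close> from
      outside.\<close>
    let ?N = "inv_into S c ` c ` S"
    have "?N \<subseteq> S" by (auto intro: inv_into_into)
    moreover have "countable ?N" using c(1) by (rule countable_image)
    moreover have "\<exists>y\<in>?N. d x y < r" if x: "x \<in> S" for x
    proof
      show "inv_into S c (c x) \<in> ?N" using x by simp
      then have "inv_into S c (c x) \<in> S" using \<open>?N \<subseteq> S\<close> by blast
      moreover have "c x = c (inv_into S c (c x))" using x by (simp add: f_inv_into_f)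
      ultimately show "d x (inv_into S c (c x)) < r" using c(2) x by metis
    qed
    ultimately show ?thesis by metis
  qed
  then obtain N where N: "\<And>r. r > 0 \<Longrightarrow> countable (N r) \<and> N r \<subseteq> S \<and> (\<forall>x\<in>S. \<exists>y\<in>N r. d x y < r)"
    by metis
  define D where "D = (\<Union>n. N (1 / real (Suc n)))"
  have "countable (N (1 / real (Suc n)))" "N (1 / real (Suc n)) \<subseteq> S" for n
    using N[of "1 / real (Suc n)"] by simp_all
  then have "countable D" "D \<subseteq> S" unfolding D_def by blast+
  moreover have "S \<subseteq> subtopology mtopology S closure_of D"
  proof
    fix x assume x: "x \<in> S"
    have "\<exists>y. y \<in> D \<and> y \<in> T" if T: "x \<in> T" "openin (subtopology mtopology S) T" for T
    proof -
      obtain r where r: "r > 0" "S \<inter> mball x r \<subseteq> T"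
        using T unfolding openin_subtopology openin_mtopology by (metis Int_commute Int_iff inf_mono subset_refl)
      obtain n where n: "1 / real (Suc n) < r" by (rule nat_approx_posE[OF r(1)])
      obtain y where "y \<in> N (1 / real (Suc n))" "d x y < 1 / real (Suc n)"
        using N[of "1 / real (Suc n)"] x by auto
      then have "y \<in> D" "y \<in> S" "d x y < r" using n \<open>D \<subseteq> S\<close> by (auto simp: D_def)
      then have "y \<in> S \<inter> mball x r" using x assms by auto
      then show ?thesis using r(2) \<open>y \<in> D\<close> by blast
    qed
    then show "x \<in> subtopology mtopology S closure_of D"
      using x assms by (auto simp: in_closure_of)
  qed
  ultimately show ?thesis
    unfolding separable_space_def using assms closure_of_subset_topspace[of "subtopology mtopology S" D]
    by (intro exI[of _ D]) auto
qed

text \<open>A function is recorded up to \<open>r\<close> by the reciprocal \<open>N\<close> of a mesh that is fine enough for it,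
  together with its rounded values on a finite net of mesh \<open>1 / N\<close>.\<close>

lemma countable_code_continuous_functions:
  fixes S :: "'a::metric_space set"
    and F :: "('a \<Rightarrow> 'b::{metric_space, second_countable_topology}) set"
  assumes S: "compact S" and F: "\<And>f. f \<in> F \<Longrightarrow> continuous_on S f" and r: "r > 0"
  obtains c :: "('a \<Rightarrow> 'b) \<Rightarrow> nat \<times> ('a \<Rightarrow> 'b)"
  where "countable (c ` F)"
    "\<And>f g x. f \<in> F \<Longrightarrow> g \<in> F \<Longrightarrow> c f = c g \<Longrightarrow> x \<in> S \<Longrightarrow> dist (f x) (g x) < r"
proof -
  obtain D :: "'b set" where D: "countable D" "\<And>X. open X \<Longrightarrow> X \<noteq> {} \<Longrightarrow> \<exists>d\<in>D. d \<in> X"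
    using countable_dense_exists by metis
  have "\<exists>d\<in>D. dist y d < r/4" for y :: 'b
    using D(2)[of "ball y (r/4)"] r by auto
  \<comment> \<open>\<open>q\<close> rounds every value to a countable dense set.\<close>
  then obtain q where q: "\<And>y. q y \<in> D" "\<And>y::'b. dist y (q y) < r/4" by metis
  have "\<exists>P. finite P \<and> P \<subseteq> S \<and> S \<subseteq> (\<Union>p\<in>P. ball p (1 / real (Suc n)))" for n
    by (rule compactE_image[OF S, of S "\<lambda>p. ball p (1 / real (Suc n))"]) (auto intro: exI)
  then obtain P where P: "\<And>n. finite (P n)" "\<And>n. P n \<subseteq> S"
    "\<And>n. S \<subseteq> (\<Union>p\<in>P n. ball p (1 / real (Suc n)))"
    by metis
  have "\<exists>n. \<forall>x\<in>S. \<forall>y\<in>S. dist x y < 1 / real (Suc n) \<longrightarrow> dist (f x) (f y) < r/4" if "f \<in> F" for f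
  proof -
    have "uniformly_continuous_on S f"
      by (rule compact_uniformly_continuous[OF F[OF that] S])
    then obtain e where e: "e > 0" "\<forall>x\<in>S. \<forall>y\<in>S. dist y x < e \<longrightarrow> dist (f y) (f x) < r/4"
      using r unfolding uniformly_continuous_on_def by (metis divide_pos_pos zero_less_numeral)
    obtain n where "1 / real (Suc n) < e" by (rule nat_approx_posE[OF e(1)])
    then show ?thesis using e(2) by (intro exI[of _ n]) (metis dist_commute less_trans)
  qed
  then obtain n where n: "\<And>f x y. f \<in> F \<Longrightarrow> x \<in> S \<Longrightarrow> y \<in> S \<Longrightarrow> dist x y < 1 / real (Suc (n f)) \<Longrightarrow>
      dist (f x) (f y) < r/4"
    by metis
  define c where "c f = (n f, restrict (q \<circ> f) (P (n f)))" for f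
  show thesis
  proof
    have "c ` F \<subseteq> Sigma UNIV (\<lambda>k. PiE (P k) (\<lambda>_. D))"
      using q(1) by (auto simp: c_def)
    moreover have "countable (Sigma UNIV (\<lambda>k. PiE (P k) (\<lambda>_. D)))"
      using D(1) P(1) by (auto intro!: countable_SIGMA countable_PiE)
    ultimately show "countable (c ` F)" by (rule countable_subset)
  next
    fix f g x assume fg: "f \<in> F" "g \<in> F" "c f = c g" and x: "x \<in> S"
    obtain p where p: "p \<in> P (n f)" "dist p x < 1 / real (Suc (n f))"
      using P(3)[of "n f"] x by auto
    have eq: "n g = n f" "q (g p) = q (f p)"
      using fg(3) p(1) by (auto simp: c_def dest!: fun_cong[of _ _ p])
    have pS: "p \<in> S" using p P(2) by blast
    \<comment> \<open>Four errors below \<open>r/4\<close> add up: from \<open>f x\<close> to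
      \<open>f p\<close>, from there to the common rounded value, then to \<open>g p\<close>, and to
      \<open>g x\<close>.\<close>
    have "dist (f x) (f p) < r/4" "dist (g x) (g p) < r/4"
      using n[OF fg(1) x pS] n[OF fg(2) x pS] p(2) eq(1) by (simp_all add: dist_commute)
    moreover have "dist (f p) (q (f p)) < r/4" "dist (g p) (q (f p)) < r/4"
      using q(2)[of "f p"] q(2)[of "g p"] eq(2) by simp_all
    ultimately show "dist (f x) (g x) < r"
      by metric
  qed
qed

section \<open>Lifts of circle maps\<close>

text \<open>The covering map rescaled to period 1, so that lifts of degree one commute with integer
  translations.\<close>

definition circ :: "real \<Rightarrow> complex"
  where "circ x = cis (2 * pi * x)"

lemma circ_in_circle [simp]: "circ x \<in> circle" "norm (circ x) = 1" "circ x \<noteq> 0"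
  by (simp_all add: circ_def)

lemma circ_0 [simp]: "circ 0 = 1" and circ_1 [simp]: "circ 1 = 1"
  by (simp_all add: circ_def)

lemma circ_add: "circ (x + y) = circ x * circ y"
  by (simp add: circ_def cis_mult distrib_left)

lemma circ_diff: "circ (x - y) = circ x / circ y"
  by (simp add: circ_def cis_divide right_diff_distrib)

lemma continuous_on_circ [continuous_intros]:
  "continuous_on A f \<Longrightarrow> continuous_on A (\<lambda>x. circ (f x))"
  unfolding circ_def by (intro continuous_intros)

lemma circ_of_int [simp]: "circ (of_int k) = 1"
  by (simp add: circ_def)

lemma circ_add_of_int [simp]: "circ (x + of_int k) = circ x"
  by (simp add: circ_add)

lemma circ_add_1 [simp]: "circ (x + 1) = circ x"
  by (simp add: circ_add)

lemma circ_eq_iff: "circ x = circ y \<longleftrightarrow> (\<exists>k::int. x = y + of_int k)"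
proof
  assume "circ x = circ y"
  then have "circ (x - y) = 1" by (simp add: circ_diff)
  then have "cos (2 * pi * (x - y)) = 1"
    by (simp add: circ_def complex_eq_iff)
  then obtain k :: int where "2 * pi * (x - y) = real_of_int k * 2 * pi"
    unfolding cos_one_2pi_int by blast
  then have "(2 * pi) * (x - y) = (2 * pi) * of_int k" by (simp only: mult.commute mult.left_commute)
  then have "x - y = of_int k" unfolding mult_cancel_left by simp
  then have "x = y + of_int k" by simp
  then show "\<exists>k::int. x = y + of_int k" by blast
qed auto

lemma circ_surj:
  assumes "z \<in> circle"
  obtains x where "0 \<le> x" "x < 1" "z = circ x"
proof
  define x where "x = Arg2pi z / (2 * pi)"
  show "0 \<le> x" "x < 1"
    using Arg2pi[of z] by (simp_all add: x_def field_simps)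
  show "z = circ x"
    using assms complex_norm_eq_1_exp[of z] by (simp add: x_def circ_def cis_conv_exp)
qed

lemma circ_Arg: "w \<noteq> 0 \<Longrightarrow> norm w = 1 \<Longrightarrow> circ (Arg w / (2 * pi)) = w"
  by (simp add: circ_def cis_Arg sgn_eq)

definition lifts :: "(real \<Rightarrow> real) \<Rightarrow> (complex \<Rightarrow> complex) \<Rightarrow> bool"
  where "lifts F f \<longleftrightarrow> (\<forall>x. f (circ x) = circ (F x))"

definition degree_one :: "(real \<Rightarrow> real) \<Rightarrow> bool"
  where "degree_one F \<longleftrightarrow> continuous_on UNIV F \<and> (\<forall>x. F (x + 1) = F x + 1)"

lemma degree_one_of_int:
  assumes "degree_one F"
  shows "F (x + of_int k) = F x + of_int k"
proof (induction k rule: int_induct[where k=0])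
  case (step1 i)
  then show ?case
    using assms[unfolded degree_one_def, THEN conjunct2, rule_format, of "x + of_int i"]
    by (simp add: add.assoc)
next
  case (step2 i)
  then show ?case
    using assms[unfolded degree_one_def, THEN conjunct2, rule_format, of "x + of_int (i - 1)"]
    by (simp add: add.assoc)
qed simp

lemma degree_one_surj:
  assumes "degree_one F"
  shows "\<exists>x. F x = y"
proof -
  define k where "k = \<lfloor>y - F 0\<rfloor>"
  have "F (of_int k) \<le> y" "y \<le> F (of_int (k + 1))"
    using degree_one_of_int[OF assms, of 0 k] degree_one_of_int[OF assms, of 0 "k + 1"]
    unfolding k_def by (simp_all add: algebra_simps) linarith+
  then show ?thesis
    using IVT'[of F "of_int k" y "of_int (k + 1)"] assms continuous_on_subset
    unfolding degree_one_def by fastforce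
qed

text \<open>Near \<open>z = circ x\<close> a preimage of \<open>w\<close> is
  \<open>x + Arg (w / z) / (2 * pi)\<close>. It depends continuously on \<open>w\<close> at
  \<open>z\<close>, because \<open>w / z\<close> is then near 1, away from the branch cut.\<close>

lemma continuous_on_circle_of_lift:
  assumes F: "continuous_on UNIV F" and f: "lifts F f"
  shows "continuous_on circle f"
  unfolding continuous_on_eq_continuous_within
proof
  fix z assume "z \<in> circle"
  then obtain x where x: "z = circ x" by (metis circ_surj)
  define h where "h w = circ (F (x + Arg (w / z) / (2 * pi)))" for w
  have eq: "f w = h w" if "w \<in> circle" for w
  proof -
    have "w / z \<noteq> 0" "norm (w / z) = 1" using that x by (auto simp: norm_divide)
    then have "circ (x + Arg (w / z) / (2 * pi)) = w"
      using x by (simp add: circ_add circ_Arg)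
    then show ?thesis using f unfolding lifts_def h_def by metis
  qed
  have F': "isCont F y" for y using F by (simp add: continuous_on_eq_continuous_at)
  have c: "isCont circ y" for y
    using continuous_on_circ[OF continuous_on_id, of UNIV] by (simp add: continuous_on_eq_continuous_at)
  have "z \<noteq> 0" using x by simp
  then have "isCont (\<lambda>w. w / z) z" "isCont Arg (z / z)"
    by (auto intro!: continuous_intros continuous_at_Arg)
  then have "isCont (\<lambda>w. Arg (w / z)) z"
    by (rule isCont_o2)
  then have "isCont (\<lambda>w. x + Arg (w / z) / (2 * pi)) z"
    by (intro continuous_intros) auto
  then have "isCont (\<lambda>w. circ (F (x + Arg (w / z) / (2 * pi)))) z"
    by (intro isCont_o2[OF _ F'] isCont_o2[OF _ c])
  then have "continuous (at z within circle) h"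
    unfolding h_def by (rule continuous_at_imp_continuous_at_within)
  then show "continuous (at z within circle) f"
    using \<open>z \<in> circle\<close> by (rule continuous_transform_within[OF _ zero_less_one]) (simp_all add: eq)
qed

text \<open>Injectivity passes to the lift, and a continuous injective real function is monotone.
  Commuting with integer translations decides the direction.\<close>

lemma degree_one_lift_inj_strict_mono:
  assumes F: "degree_one F" "lifts F f" and inj: "inj_on f circle"
  shows "strict_mono F"
proof -
  have injF: "inj F"
  proof (rule injI)
    fix x y assume xy: "F x = F y"
    then have "f (circ x) = f (circ y)" using F by (simp add: lifts_def)
    then have "circ x = circ y" using inj by (simp add: inj_on_eq_iff)
    then obtain k :: int where k: "x = y + of_int k" unfolding circ_eq_iff by blast
    then show "x = y" using degree_one_of_int[OF F(1), of y k] xy by simp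
  qed
  show ?thesis
  proof (rule strict_monoI)
    fix x y :: real assume "x < y"
    \<comment> \<open>An integer translate of \<open>x\<close> beyond \<open>y\<close>;
      \<open>F x < F b\<close> rules out that \<open>F\<close> decreases on the interval.\<close>
    define b where "b = x + of_int (\<lfloor>y - x\<rfloor> + 1)"
    have "y < b" by (simp add: b_def) linarith
    moreover have "0 \<le> \<lfloor>y - x\<rfloor>" using \<open>x < y\<close> by simp
    then have "F x < F b" unfolding b_def degree_one_of_int[OF F(1)] by linarith
    moreover have "continuous_on {x..b} F"
      using F(1) continuous_on_subset unfolding degree_one_def by blast
    ultimately show "F x < F y"
      using continuous_inj_imp_mono[of x y b F] \<open>x < y\<close> inj_on_subset[OF injF, of "{x..b}"] by auto
  qed
qed

text \<open>The increment over a period is a positive integer. If it exceeded 1, then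
  \<open>F\<close> would take the value \<open>F x + 1\<close> strictly inside the period, and
  \<open>f\<close> would identify two distinct points.\<close>

lemma strict_mono_lift_degree_one:
  assumes F: "continuous_on UNIV F" "strict_mono F" "lifts F f" and inj: "inj_on f circle"
  shows "degree_one F"
  unfolding degree_one_def
proof (intro conjI allI F)
  fix x
  have "circ (F (x + 1)) = circ (F x)" using F(3) unfolding lifts_def by (metis circ_add_1)
  then obtain k :: int where k: "F (x + 1) = F x + of_int k" unfolding circ_eq_iff by blast
  have "k > 0" using strict_monoD[OF F(2), of x "x + 1"] k by simp
  moreover have "\<not> k > 1"
  proof
    assume "k > 1"
    then have "\<exists>y. x \<le> y \<and> y \<le> x + 1 \<and> F y = F x + 1"
      using k F(1) by (intro IVT') (auto intro: continuous_on_subset)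
    then obtain y where y: "x \<le> y" "y \<le> x + 1" "F y = F x + 1" by blast
    then have "y \<noteq> x" "y \<noteq> x + 1" using \<open>k > 1\<close> k by auto
    moreover have "f (circ y) = f (circ x)" using F(3) y by (simp add: lifts_def)
    then have "circ y = circ x" using inj by (simp add: inj_on_eq_iff)
    then obtain j :: int where "y = x + of_int j" unfolding circ_eq_iff by blast
    ultimately show False using y by auto
  qed
  ultimately have "k = 1" by linarith
  then show "F (x + 1) = F x + 1" using k by simp
qed

text \<open>Membership in the group becomes a condition on lifts, which is easy to verify for
  explicit constructions.\<close>

lemma carrier_Homeo_plus_circle:
  "f \<in> carrier Homeo_plus_circle \<longleftrightarrow>
    f \<in> extensional circle \<and> (\<exists>F. degree_one F \<and> strict_mono F \<and> lifts F f)"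
proof
  assume f: "f \<in> carrier Homeo_plus_circle"
  then have B: "f \<in> Bij circle" "orientation_preserving f" by (auto simp: Homeo_plus_circle_def)
  then obtain F where F: "continuous_on UNIV F" "strict_mono F" "\<And>t. f (cis t) = cis (F t)"
    by (auto simp: orientation_preserving_def)
  \<comment> \<open>The lift is rescaled from period \<open>2 * pi\<close> to period 1.\<close>
  define G where "G x = F (2 * pi * x) / (2 * pi)" for x
  have G: "continuous_on UNIV G"
    unfolding G_def by (intro continuous_intros continuous_on_compose2[OF F(1)]) auto
  have "strict_mono G"
    using F(2) by (auto simp: G_def strict_mono_def divide_strict_right_mono)
  moreover have "lifts G f"
    by (simp add: lifts_def G_def circ_def F(3))
  moreover have "inj_on f circle" using B(1) by (simp add: Bij_def bij_betw_def)
  ultimately show "f \<in> extensional circle \<and> (\<exists>F. degree_one F \<and> strict_mono F \<and> lifts F f)"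
    using strict_mono_lift_degree_one[OF G] B(1) Bij_imp_extensional by blast
next
  assume "f \<in> extensional circle \<and> (\<exists>F. degree_one F \<and> strict_mono F \<and> lifts F f)"
  then obtain F where f: "f \<in> extensional circle" and F: "degree_one F" "strict_mono F" "lifts F f"
    by blast
  have cont: "continuous_on circle f"
    using F continuous_on_circle_of_lift by (auto simp: degree_one_def)
  have inj: "inj_on f circle"
  proof (rule inj_onI)
    fix z w assume zw: "z \<in> circle" "w \<in> circle" "f z = f w"
    obtain x y where xy: "z = circ x" "w = circ y" using zw circ_surj by metis
    then have "circ (F x) = circ (F y)" using zw F(3) by (simp add: lifts_def)
    then obtain k :: int where "F x = F y + of_int k" unfolding circ_eq_iff by blast
    then have "F x = F (y + of_int k)" using degree_one_of_int[OF F(1)] by simp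
    then have "x = y + of_int k" using F(2) by (simp add: strict_mono_eq)
    then show "z = w" using xy by simp
  qed
  have im: "f ` circle = circle"
  proof (intro equalityI subsetI)
    fix w assume "w \<in> f ` circle"
    then obtain x where "w = f (circ x)" by (metis circ_surj imageE)
    then show "w \<in> circle" using F(3) by (simp add: lifts_def del: mem_sphere mem_sphere_0)
  next
    fix w assume "w \<in> circle"
    then obtain y where y: "w = circ y" by (metis circ_surj)
    obtain x where "F x = y" using degree_one_surj[OF F(1)] by blast
    then have "w = f (circ x)" using y F(3) by (simp add: lifts_def)
    then show "w \<in> f ` circle" by (metis circ_in_circle(1) imageI)
  qed
  \<comment> \<open>A continuous bijection from a compact space to a Hausdorff space is a
    homeomorphism.\<close>
  have "homeomorphic_map (top_of_set circle) (top_of_set circle) f"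
    using cont im inj equalityD1[OF im, unfolded image_subset_iff_funcset]
    by (intro continuous_imp_homeomorphic_map) (simp_all add: compact_space_subtopology Hausdorff_space_subtopology)
  moreover have "orientation_preserving f"
    unfolding orientation_preserving_def
  proof (intro exI conjI allI)
    let ?G = "\<lambda>t. 2 * pi * F (t / (2 * pi))"
    show "continuous_on UNIV ?G"
      using F(1)[unfolded degree_one_def, THEN conjunct1]
      by (intro continuous_on_mult_left continuous_on_compose2[of UNIV F UNIV "\<lambda>t. t / (2 * pi)"]
          continuous_on_divide continuous_on_const continuous_on_id) auto
    show "strict_mono ?G"
      using F(2) by (auto simp: strict_mono_def divide_strict_right_mono)
    show "f (cis t) = cis (?G t)" for t
      using F(3)[unfolded lifts_def, rule_format, of "t / (2 * pi)"] by (simp add: circ_def)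
  qed
  moreover have "f \<in> Bij circle" using f inj im by (simp add: Bij_def bij_betw_def)
  ultimately show "f \<in> carrier Homeo_plus_circle" by (simp add: Homeo_plus_circle_def)
qed

lemma Homeo_plus_circle_props:
  assumes "f \<in> carrier Homeo_plus_circle"
  shows "f \<in> Bij circle" "f ` circle = circle" "inj_on f circle" "continuous_on circle f"
    "f \<in> extensional circle" "z \<in> circle \<Longrightarrow> f z \<in> circle"
proof -
  show *: "f \<in> Bij circle" using assms by (simp add: Homeo_plus_circle_def)
  then show "f ` circle = circle" "inj_on f circle" "f \<in> extensional circle"
    "z \<in> circle \<Longrightarrow> f z \<in> circle"
    by (auto simp: Bij_def bij_betw_def)
  show "continuous_on circle f"
    using assms continuous_on_circle_of_lift unfolding carrier_Homeo_plus_circle degree_one_def by blast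
qed

section \<open>The group structure, through composition and inversion of lifts\<close>

lemma degree_one_comp:
  assumes "degree_one F" "degree_one G"
  shows "degree_one (F \<circ> G)"
proof -
  have "continuous_on UNIV (F \<circ> G)"
    using assms unfolding degree_one_def by (metis continuous_on_compose continuous_on_subset subset_UNIV)
  then show ?thesis using assms by (simp add: degree_one_def)
qed

lemma degree_one_strict_mono_inv:
  assumes F: "degree_one F" "strict_mono F"
  shows "degree_one (inv_into UNIV F)" "strict_mono (inv_into UNIV F)" "F (inv_into UNIV F x) = x"
proof -
  have "surj F" using degree_one_surj[OF F(1)] by (metis surj_def)
  then show inv: "F (inv_into UNIV F x) = x" for x by (rule surj_f_inv_f)
  show mono: "strict_mono (inv_into UNIV F)"
    using F(2) inv by (metis strict_mono_less strict_monoI)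
  have injF: "inv_into UNIV F (F x) = x" for x using F(2) by (simp add: strict_mono_imp_inj_on)
  \<comment> \<open>An increasing function onto the line has no jumps, hence is continuous.\<close>
  have "range (inv_into UNIV F) = UNIV" using injF by (metis surjI)
  then have "continuous_on UNIV (inv_into UNIV F)"
    using mono by (intro continuous_onI_mono) (auto simp: strict_mono_less_eq)
  moreover have "inv_into UNIV F (x + 1) = inv_into UNIV F x + 1" for x
    using F(1) inv injF unfolding degree_one_def by metis
  ultimately show "degree_one (inv_into UNIV F)" by (simp add: degree_one_def)
qed

lemma subgroup_Homeo_plus_circle: "subgroup (carrier Homeo_plus_circle) (BijGroup circle)"
proof (rule group.subgroupI[OF group_BijGroup])
  show "carrier Homeo_plus_circle \<subseteq> carrier (BijGroup circle)"
    using Homeo_plus_circle_props(1) by (auto simp: BijGroup_def)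
  have "(\<lambda>z\<in>circle. z) \<in> carrier Homeo_plus_circle"
    unfolding carrier_Homeo_plus_circle
    by (auto intro!: exI[of _ "\<lambda>x. x"] simp: degree_one_def strict_mono_def lifts_def)
  then show "carrier Homeo_plus_circle \<noteq> {}" by blast
next
  fix f assume f: "f \<in> carrier Homeo_plus_circle"
  then obtain F where F: "degree_one F" "strict_mono F" "lifts F f"
    unfolding carrier_Homeo_plus_circle by blast
  have "inv_into circle f (circ x) = circ (inv_into UNIV F x)" for x
  proof -
    have "f (circ (inv_into UNIV F x)) = circ x"
      using F(3) degree_one_strict_mono_inv(3)[OF F(1,2)] by (simp add: lifts_def)
    then show ?thesis using Homeo_plus_circle_props(3)[OF f] by (metis circ_in_circle(1) inv_into_f_f)
  qed
  then have "lifts (inv_into UNIV F) (\<lambda>z\<in>circle. inv_into circle f z)"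
    unfolding lifts_def by simp
  then have "(\<lambda>z\<in>circle. inv_into circle f z) \<in> carrier Homeo_plus_circle"
    unfolding carrier_Homeo_plus_circle using degree_one_strict_mono_inv(1,2)[OF F(1,2)]
    by (intro conjI restrict_extensional exI[of _ "inv_into UNIV F"])
  then show "inv\<^bsub>BijGroup circle\<^esub> f \<in> carrier Homeo_plus_circle"
    using inv_BijGroup[OF Homeo_plus_circle_props(1)[OF f]] by simp
next
  fix f g assume f: "f \<in> carrier Homeo_plus_circle" and g: "g \<in> carrier Homeo_plus_circle"
  then obtain F G where F: "degree_one F" "strict_mono F" "lifts F f"
    and G: "degree_one G" "strict_mono G" "lifts G g"
    unfolding carrier_Homeo_plus_circle by blast
  have "lifts (F \<circ> G) (compose circle f g)"
    using F(3) G(3) by (simp add: lifts_def compose_eq)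
  moreover have "strict_mono (F \<circ> G)" using F(2) G(2) by (rule strict_mono_o)
  ultimately have "compose circle f g \<in> carrier Homeo_plus_circle"
    unfolding carrier_Homeo_plus_circle
    using degree_one_comp[OF F(1) G(1)] by (intro conjI compose_extensional exI[of _ "F \<circ> G"])
  then show "f \<otimes>\<^bsub>BijGroup circle\<^esub> g \<in> carrier Homeo_plus_circle"
    using Homeo_plus_circle_props(1)[OF f] Homeo_plus_circle_props(1)[OF g] by (simp add: BijGroup_def)
qed

lemma group_Homeo_plus_circle: "group Homeo_plus_circle"
proof -
  have "Homeo_plus_circle = BijGroup circle \<lparr>carrier := carrier Homeo_plus_circle\<rparr>"
    by (simp add: Homeo_plus_circle_def)
  then show ?thesis
    using subgroup.subgroup_is_group[OF subgroup_Homeo_plus_circle group_BijGroup] by metis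
qed

lemma Homeo_plus_circle_mult:
  assumes "f \<in> carrier Homeo_plus_circle" "g \<in> carrier Homeo_plus_circle"
  shows "f \<otimes>\<^bsub>Homeo_plus_circle\<^esub> g = compose circle f g"
  using Homeo_plus_circle_props(1)[OF assms(1)] Homeo_plus_circle_props(1)[OF assms(2)]
  by (simp add: Homeo_plus_circle_def BijGroup_def)

lemma Homeo_plus_circle_mult_apply:
  assumes "f \<in> carrier Homeo_plus_circle" "g \<in> carrier Homeo_plus_circle" "z \<in> circle"
  shows "(f \<otimes>\<^bsub>Homeo_plus_circle\<^esub> g) z = f (g z)"
  using assms by (simp add: Homeo_plus_circle_mult compose_eq)

lemma Homeo_plus_circle_one: "\<one>\<^bsub>Homeo_plus_circle\<^esub> = (\<lambda>z\<in>circle. z)"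
  by (simp add: Homeo_plus_circle_def BijGroup_def)

lemma Homeo_plus_circle_inv_apply:
  assumes f: "f \<in> carrier Homeo_plus_circle" and z: "z \<in> circle"
  shows "f ((inv\<^bsub>Homeo_plus_circle\<^esub> f) z) = z" "(inv\<^bsub>Homeo_plus_circle\<^esub> f) (f z) = z"
proof -
  interpret group Homeo_plus_circle by (rule group_Homeo_plus_circle)
  show "f ((inv\<^bsub>Homeo_plus_circle\<^esub> f) z) = z" "(inv\<^bsub>Homeo_plus_circle\<^esub> f) (f z) = z"
    using Homeo_plus_circle_mult_apply[OF f inv_closed[OF f] z]
      Homeo_plus_circle_mult_apply[OF inv_closed[OF f] f z] f z
    by (simp_all add: Homeo_plus_circle_one)
qed

section \<open>The Polish topology of the circle group\<close>

abbreviation circle_metric :: "complex metric"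
  where "circle_metric \<equiv> submetric euclidean_metric circle"

abbreviation circle_maps :: "(complex \<Rightarrow> complex) metric"
  where "circle_maps \<equiv> cfunspace (top_of_set circle) circle_metric"

lemma mtopology_of_circle_metric: "mtopology_of circle_metric = top_of_set circle"
  by (simp add: mtopology_of_submetric)

lemma compact_space_circle: "compact_space (top_of_set circle)"
  by (simp add: compact_space_subtopology)

lemma compact_open_topology_circle:
  "compact_open_topology (top_of_set circle) (top_of_set circle) = mtopology_of circle_maps"
  using compact_open_topology_eq_cfunspace[OF compact_space_circle, of circle_metric]
  unfolding mtopology_of_circle_metric .

lemma mspace_circle_maps:
  "f \<in> mspace circle_maps \<longleftrightarrow> f \<in> extensional circle \<and> continuous_on circle f \<and> f \<in> circle \<rightarrow> circle"
proof -
  have "compactin (top_of_set circle) (topspace (top_of_set circle))"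
    using compact_space_circle unfolding compact_space_def .
  from compactin_mspace_cfunspace[OF this, of circle_metric] show ?thesis
    unfolding mtopology_of_circle_metric by (auto simp: Pi_iff)
qed

lemma Homeo_subset_circle_maps: "carrier Homeo_plus_circle \<subseteq> mspace circle_maps"
  unfolding subset_iff mspace_circle_maps using Homeo_plus_circle_props by blast

lemma Homeo_plus_circle_topology_eq:
  "Homeo_plus_circle_topology = subtopology (mtopology_of circle_maps) (carrier Homeo_plus_circle)"
  unfolding Homeo_plus_circle_topology_def compact_open_topology_circle ..

lemma topspace_Homeo_plus_circle: "topspace Homeo_plus_circle_topology = carrier Homeo_plus_circle"
  unfolding Homeo_plus_circle_topology_eq using Homeo_subset_circle_maps by (simp add: Int_absorb1)

lemma openin_circle_maps:
  "openin (mtopology_of circle_maps) \<U> \<longleftrightarrow> \<U> \<subseteq> mspace circle_maps \<and>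
    (\<forall>f\<in>\<U>. \<exists>r>0. \<forall>g\<in>mspace circle_maps. (\<forall>z\<in>circle. dist (f z) (g z) < r) \<longrightarrow> g \<in> \<U>)"
  using openin_compact_open_metric[OF compact_space_circle, of circle_metric \<U>]
  unfolding mtopology_of_circle_metric compact_open_topology_circle
  by (simp del: mspace_cfunspace mem_sphere mem_sphere_0)

lemma Homeo_plus_circle_nhd:
  assumes f: "f \<in> carrier Homeo_plus_circle" and r: "r > 0"
  obtains U where "openin Homeo_plus_circle_topology U" "f \<in> U"
    "\<And>g z. g \<in> U \<Longrightarrow> z \<in> circle \<Longrightarrow> dist (f z) (g z) < r"
proof -
  interpret C: Metric_space "mspace circle_maps" "mdist circle_maps"
    by (rule Metric_space_mspace_mdist)
  have fC: "f \<in> mspace circle_maps" using f Homeo_subset_circle_maps by blast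
  show thesis
  proof
    show "openin Homeo_plus_circle_topology (C.mball f r \<inter> carrier Homeo_plus_circle)"
      unfolding Homeo_plus_circle_topology_eq mtopology_of_def
      by (rule openin_subtopology_Int[OF C.openin_mball])
    show "f \<in> C.mball f r \<inter> carrier Homeo_plus_circle" using f fC r by (simp del: mspace_cfunspace)
    fix g z assume "g \<in> C.mball f r \<inter> carrier Homeo_plus_circle" "z \<in> circle"
    then show "dist (f z) (g z) < r"
      using cfunspace_mdist_lt[of "top_of_set circle" f circle_metric g r z] fC compact_space_circle
      by (simp add: compact_space_def del: mspace_cfunspace mem_sphere mem_sphere_0)
  qed
qed

text \<open>Openness expressed by pointwise distances, so that the later estimates need not handle
  the supremum metric.\<close>

lemma openin_Homeo_plus_circle_topology:
  "openin Homeo_plus_circle_topology \<U> \<longleftrightarrow> \<U> \<subseteq> carrier Homeo_plus_circle \<and>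
    (\<forall>f\<in>\<U>. \<exists>r>0. \<forall>g\<in>carrier Homeo_plus_circle. (\<forall>z\<in>circle. dist (f z) (g z) < r) \<longrightarrow> g \<in> \<U>)"
    (is "?l \<longleftrightarrow> ?r")
proof
  assume ?l
  then obtain V where V: "openin (mtopology_of circle_maps) V" "\<U> = V \<inter> carrier Homeo_plus_circle"
    unfolding Homeo_plus_circle_topology_eq openin_subtopology by blast
  show ?r
  proof (intro conjI ballI)
    show "\<U> \<subseteq> carrier Homeo_plus_circle" using V by blast
    fix f assume "f \<in> \<U>"
    then obtain r where "r > 0" "\<forall>g\<in>mspace circle_maps. (\<forall>z\<in>circle. dist (f z) (g z) < r) \<longrightarrow> g \<in> V"
      using V unfolding openin_circle_maps by blast
    then show "\<exists>r>0. \<forall>g\<in>carrier Homeo_plus_circle. (\<forall>z\<in>circle. dist (f z) (g z) < r) \<longrightarrow> g \<in> \<U>"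
      using Homeo_subset_circle_maps V(2) by (intro exI[of _ r]) blast
  qed
next
  assume r: ?r
  show ?l
  proof (subst openin_subopen, intro ballI)
    fix f assume f: "f \<in> \<U>"
    then obtain r where r': "r > 0"
      "\<forall>g\<in>carrier Homeo_plus_circle. (\<forall>z\<in>circle. dist (f z) (g z) < r) \<longrightarrow> g \<in> \<U>"
      using r by meson
    have fG: "f \<in> carrier Homeo_plus_circle" using f r by blast
    obtain U where U: "openin Homeo_plus_circle_topology U" "f \<in> U"
      "\<And>g z. g \<in> U \<Longrightarrow> z \<in> circle \<Longrightarrow> dist (f z) (g z) < r"
      using Homeo_plus_circle_nhd[OF fG r'(1)] by metis
    have "U \<subseteq> carrier Homeo_plus_circle"
      using openin_subset[OF U(1)] unfolding topspace_Homeo_plus_circle .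
    then have "U \<subseteq> \<U>" using U(3) r'(2) by blast
    then show "\<exists>T. openin Homeo_plus_circle_topology T \<and> f \<in> T \<and> T \<subseteq> \<U>" using U by blast
  qed
qed

section \<open>Continuity of the action and of the group operations\<close>

lemma Homeo_uniformly_continuous:
  assumes "f \<in> carrier Homeo_plus_circle" "r > 0"
  obtains d where "d > 0" "\<And>z w. z \<in> circle \<Longrightarrow> w \<in> circle \<Longrightarrow> dist z w < d \<Longrightarrow> dist (f z) (f w) < r"
proof -
  have "uniformly_continuous_on circle f"
    by (rule compact_uniformly_continuous[OF Homeo_plus_circle_props(4)[OF assms(1)] compact_sphere])
  then obtain d where "d > 0" "\<forall>z\<in>circle. \<forall>w\<in>circle. dist w z < d \<longrightarrow> dist (f w) (f z) < r"
    using assms(2) unfolding uniformly_continuous_on_def by metis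
  then show thesis using that by blast
qed

lemma continuous_map_Homeo_action:
  "continuous_map (prod_topology Homeo_plus_circle_topology (top_of_set circle)) (top_of_set circle) (\<lambda>(g, z). g z)"
  unfolding continuous_map_def
proof (intro conjI allI impI)
  let ?P = "prod_topology Homeo_plus_circle_topology (top_of_set circle)"
  have T: "topspace ?P = carrier Homeo_plus_circle \<times> circle"
    by (simp add: topspace_Homeo_plus_circle)
  show "(\<lambda>(g, z). g z) \<in> topspace ?P \<rightarrow> topspace (top_of_set circle)"
    unfolding T using Homeo_plus_circle_props(6) by fastforce
  fix U assume U: "openin (top_of_set circle) U"
  show "openin ?P {p \<in> topspace ?P. (case p of (g, z) \<Rightarrow> g z) \<in> U}"
    unfolding openin_prod_topology_alt
  proof (intro allI impI)
    fix g z assume "(g, z) \<in> {p \<in> topspace ?P. (case p of (g, z) \<Rightarrow> g z) \<in> U}"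
    then have gz: "g \<in> carrier Homeo_plus_circle" "z \<in> circle" "g z \<in> U" unfolding T by auto
    obtain r where r: "r > 0" "\<forall>w\<in>circle. dist w (g z) < r \<longrightarrow> w \<in> U"
      using U gz(3) unfolding openin_euclidean_subtopology_iff by metis
    have r2: "r / 2 > 0" using r by simp
    obtain d where d: "d > 0" "\<And>z w. z \<in> circle \<Longrightarrow> w \<in> circle \<Longrightarrow> dist z w < d \<Longrightarrow> dist (g z) (g w) < r/2"
      using Homeo_uniformly_continuous[OF gz(1) r2] by metis
    obtain V where V: "openin Homeo_plus_circle_topology V" "g \<in> V"
      "\<And>h z. h \<in> V \<Longrightarrow> z \<in> circle \<Longrightarrow> dist (g z) (h z) < r/2"
      using Homeo_plus_circle_nhd[OF gz(1) r2] by metis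
    have VG: "V \<subseteq> carrier Homeo_plus_circle"
      using openin_subset[OF V(1)] unfolding topspace_Homeo_plus_circle .
    have "h w \<in> U" if "h \<in> V" "w \<in> ball z d \<inter> circle" for h w
    proof -
      have "h w \<in> circle" using Homeo_plus_circle_props(6) VG that by blast
      moreover have "dist (h w) (g z) < r"
        using V(3)[of h w] d(2)[of z w] that gz(2) by (smt (verit) IntE dist_commute dist_triangle mem_ball field_sum_of_halves)
      ultimately show ?thesis using r by blast
    qed
    moreover have "openin (top_of_set circle) (ball z d \<inter> circle)" by (auto simp: openin_open)
    moreover have "z \<in> ball z d \<inter> circle" using gz d by simp
    ultimately show "\<exists>V W. openin Homeo_plus_circle_topology V \<and> openin (top_of_set circle) W \<and>
        g \<in> V \<and> z \<in> W \<and> V \<times> W \<subseteq> {p \<in> topspace ?P. (case p of (g, z) \<Rightarrow> g z) \<in> U}"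
      using V(1,2) VG unfolding T by (intro exI[of _ V] exI[of _ "ball z d \<inter> circle"]) auto
  qed
qed

lemma topological_group_Homeo_plus_circle:
  "topological_group Homeo_plus_circle Homeo_plus_circle_topology"
proof -
  interpret group Homeo_plus_circle by (rule group_Homeo_plus_circle)
  let ?G = "carrier Homeo_plus_circle" and ?T = "Homeo_plus_circle_topology"
  note T = topspace_Homeo_plus_circle
  show ?thesis
  proof
    show "topspace ?T = ?G" by (rule T)
    show "continuous_map (prod_topology ?T ?T) ?T (\<lambda>(g, h). g \<otimes>\<^bsub>Homeo_plus_circle\<^esub> h)"
      unfolding continuous_map_def
    proof (intro conjI allI impI)
      show "(\<lambda>(g, h). g \<otimes>\<^bsub>Homeo_plus_circle\<^esub> h) \<in> topspace (prod_topology ?T ?T) \<rightarrow> topspace ?T"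
        by (auto simp: T)
      fix U assume U: "openin ?T U"
      let ?S = "{p \<in> topspace (prod_topology ?T ?T). (case p of (g, h) \<Rightarrow> g \<otimes>\<^bsub>Homeo_plus_circle\<^esub> h) \<in> U}"
      show "openin (prod_topology ?T ?T) ?S"
        unfolding openin_prod_topology_alt
      proof (intro allI impI)
        fix g h assume "(g, h) \<in> ?S"
        then have gh: "g \<in> ?G" "h \<in> ?G" "g \<otimes>\<^bsub>Homeo_plus_circle\<^esub> h \<in> U" by (auto simp: T)
        obtain r where r: "r > 0"
          "\<And>k. k \<in> ?G \<Longrightarrow> \<forall>z\<in>circle. dist ((g \<otimes>\<^bsub>Homeo_plus_circle\<^esub> h) z) (k z) < r \<Longrightarrow> k \<in> U"
          using U gh(3) unfolding openin_Homeo_plus_circle_topology by metis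
        have r2: "r / 2 > 0" using r by simp
        obtain d where d: "d > 0" "\<And>z w. z \<in> circle \<Longrightarrow> w \<in> circle \<Longrightarrow> dist z w < d \<Longrightarrow> dist (g z) (g w) < r/2"
          using Homeo_uniformly_continuous[OF gh(1) r2] by metis
        obtain V where V: "openin ?T V" "g \<in> V" "\<And>h z. h \<in> V \<Longrightarrow> z \<in> circle \<Longrightarrow> dist (g z) (h z) < r/2"
          using Homeo_plus_circle_nhd[OF gh(1) r2] by metis
        obtain W where W: "openin ?T W" "h \<in> W" "\<And>k z. k \<in> W \<Longrightarrow> z \<in> circle \<Longrightarrow> dist (h z) (k z) < d"
          using Homeo_plus_circle_nhd[OF gh(2) d(1)] by metis
        have VW: "V \<subseteq> ?G" "W \<subseteq> ?G"
          using openin_subset[OF V(1)] openin_subset[OF W(1)] unfolding T .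
        have "v \<otimes>\<^bsub>Homeo_plus_circle\<^esub> w \<in> U" if vw: "v \<in> V" "w \<in> W" for v w
        proof (rule r(2))
          have vwG: "v \<in> ?G" "w \<in> ?G" using vw VW by auto
          then show "v \<otimes>\<^bsub>Homeo_plus_circle\<^esub> w \<in> ?G" by simp
          show "\<forall>z\<in>circle. dist ((g \<otimes>\<^bsub>Homeo_plus_circle\<^esub> h) z) ((v \<otimes>\<^bsub>Homeo_plus_circle\<^esub> w) z) < r"
          proof
            fix z assume z: "z \<in> circle"
            have hz: "h z \<in> circle" "w z \<in> circle" using Homeo_plus_circle_props(6) gh vwG z by auto
            \<comment> \<open>First the inner map changes, controlled by uniform continuity of
              \<open>g\<close>; then the outer one, controlled by uniform closeness of
              \<open>v\<close> to \<open>g\<close>.\<close>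
            have "dist (g (h z)) (g (w z)) < r/2" using d(2)[OF hz] W(3)[OF vw(2) z] .
            moreover have "dist (g (w z)) (v (w z)) < r/2" using V(3)[OF vw(1) hz(2)] .
            ultimately have "dist (g (h z)) (v (w z)) < r" by metric
            then show "dist ((g \<otimes>\<^bsub>Homeo_plus_circle\<^esub> h) z) ((v \<otimes>\<^bsub>Homeo_plus_circle\<^esub> w) z) < r"
              using gh vwG z by (simp only: Homeo_plus_circle_mult_apply)
          qed
        qed
        then have "V \<times> W \<subseteq> ?S" using VW by (auto simp: T)
        then show "\<exists>V W. openin ?T V \<and> openin ?T W \<and> g \<in> V \<and> h \<in> W \<and> V \<times> W \<subseteq> ?S"
          using V(1,2) W(1,2) by (intro exI[of _ V] exI[of _ W] conjI)
      qed
    qed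
    show "continuous_map ?T ?T (\<lambda>g. inv\<^bsub>Homeo_plus_circle\<^esub> g)"
      unfolding continuous_map_def
    proof (intro conjI allI impI)
      show "(\<lambda>g. inv\<^bsub>Homeo_plus_circle\<^esub> g) \<in> topspace ?T \<rightarrow> topspace ?T" by (auto simp: T)
      fix U assume U: "openin ?T U"
      show "openin ?T {g \<in> topspace ?T. inv\<^bsub>Homeo_plus_circle\<^esub> g \<in> U}"
        unfolding openin_Homeo_plus_circle_topology[of "{g \<in> topspace ?T. inv\<^bsub>Homeo_plus_circle\<^esub> g \<in> U}"]
      proof (intro conjI ballI)
        show "{g \<in> topspace ?T. inv\<^bsub>Homeo_plus_circle\<^esub> g \<in> U} \<subseteq> ?G" by (auto simp: T)
        fix g assume "g \<in> {g \<in> topspace ?T. inv\<^bsub>Homeo_plus_circle\<^esub> g \<in> U}"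
        then have g: "g \<in> ?G" "inv\<^bsub>Homeo_plus_circle\<^esub> g \<in> U" by (auto simp: T)
        obtain r where r: "r > 0"
          "\<And>k. k \<in> ?G \<Longrightarrow> \<forall>z\<in>circle. dist ((inv\<^bsub>Homeo_plus_circle\<^esub> g) z) (k z) < r \<Longrightarrow> k \<in> U"
          using U g(2) unfolding openin_Homeo_plus_circle_topology by metis
        obtain d where d: "d > 0" "\<And>z w. z \<in> circle \<Longrightarrow> w \<in> circle \<Longrightarrow> dist z w < d \<Longrightarrow>
            dist ((inv\<^bsub>Homeo_plus_circle\<^esub> g) z) ((inv\<^bsub>Homeo_plus_circle\<^esub> g) w) < r"
          using Homeo_uniformly_continuous[OF inv_closed[OF g(1)] r(1)] by metis
        have "inv\<^bsub>Homeo_plus_circle\<^esub> k \<in> U" if k: "k \<in> ?G" "\<forall>z\<in>circle. dist (g z) (k z) < d" for k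
        proof (rule r(2))
          show "inv\<^bsub>Homeo_plus_circle\<^esub> k \<in> ?G" using k by simp
          show "\<forall>z\<in>circle. dist ((inv\<^bsub>Homeo_plus_circle\<^esub> g) z) ((inv\<^bsub>Homeo_plus_circle\<^esub> k) z) < r"
          proof
            fix z assume z: "z \<in> circle"
            \<comment> \<open>With \<open>z = k w\<close>, closeness of \<open>k\<close> to
              \<open>g\<close> at \<open>w\<close> makes \<open>z\<close> close to
              \<open>g w\<close>. Uniform continuity of the inverse of \<open>g\<close> then
              compares its value at \<open>z\<close> with \<open>w\<close>, which is the value of
              the inverse of \<open>k\<close>.\<close>
            define w where "w = (inv\<^bsub>Homeo_plus_circle\<^esub> k) z"
            have w: "w \<in> circle" "k w = z"
              using z k Homeo_plus_circle_props(6)[OF inv_closed[OF k(1)]] Homeo_plus_circle_inv_apply(1)[OF k(1) z] by (simp_all only: w_def)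
            have "dist z (g w) < d" using k(2) w by (metis dist_commute)
            then have "dist ((inv\<^bsub>Homeo_plus_circle\<^esub> g) z) ((inv\<^bsub>Homeo_plus_circle\<^esub> g) (g w)) < r"
              using d(2)[OF z] Homeo_plus_circle_props(6)[OF g(1) w(1)] by blast
            then show "dist ((inv\<^bsub>Homeo_plus_circle\<^esub> g) z) ((inv\<^bsub>Homeo_plus_circle\<^esub> k) z) < r"
              unfolding Homeo_plus_circle_inv_apply(2)[OF g(1) w(1)] by (simp only: w_def)
          qed
        qed
        then show "\<exists>r>0. \<forall>k\<in>?G. (\<forall>z\<in>circle. dist (g z) (k z) < r) \<longrightarrow>
            k \<in> {g \<in> topspace ?T. inv\<^bsub>Homeo_plus_circle\<^esub> g \<in> U}"
          using d(1) unfolding T by blast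
      qed
    qed
  qed
qed

section \<open>Separability and complete metrizability\<close>

lemma separable_Homeo_plus_circle: "separable_space Homeo_plus_circle_topology"
proof -
  interpret C: Metric_space "mspace circle_maps" "mdist circle_maps"
    by (rule Metric_space_mspace_mdist)
  have "\<exists>c :: (complex \<Rightarrow> complex) \<Rightarrow> nat \<times> (complex \<Rightarrow> complex). countable (c ` carrier Homeo_plus_circle) \<and>
      (\<forall>f\<in>carrier Homeo_plus_circle. \<forall>g\<in>carrier Homeo_plus_circle. c f = c g \<longrightarrow> mdist circle_maps f g < r)"
    if r: "r > 0" for r
  proof -
    have "r / 2 > 0" using r by simp
    then obtain c :: "(complex \<Rightarrow> complex) \<Rightarrow> nat \<times> (complex \<Rightarrow> complex)"
      where c: "countable (c ` carrier Homeo_plus_circle)"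
        "\<And>f g z. f \<in> carrier Homeo_plus_circle \<Longrightarrow> g \<in> carrier Homeo_plus_circle \<Longrightarrow> c f = c g \<Longrightarrow>
          z \<in> circle \<Longrightarrow> dist (f z) (g z) < r / 2"
      using countable_code_continuous_functions[OF compact_sphere Homeo_plus_circle_props(4)] by metis
    have "mdist circle_maps f g < r"
      if "f \<in> carrier Homeo_plus_circle" "g \<in> carrier Homeo_plus_circle" "c f = c g" for f g
    proof -
      have "mdist circle_maps f g \<le> r / 2"
        using c(2)[OF that] r by (intro mdist_cfunspace_le) (auto intro: less_imp_le simp del: mem_sphere_0 mem_sphere)
      then show ?thesis using r by simp
    qed
    with c(1) show ?thesis by blast
  qed
  then show ?thesis
    using C.separable_space_subtopologyI[OF Homeo_subset_circle_maps]
    unfolding Homeo_plus_circle_topology_eq mtopology_of_def by metis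
qed

text \<open>The quotient of the two maps along \<open>circ\<close> stays within distance less than 1
  of 1, hence in the right half plane, where \<open>Arg\<close> is continuous. Adding its angle to
  \<open>F\<close> gives a lift of \<open>g\<close>; the angle is periodic, so the degree does not
  change.\<close>

lemma degree_one_lift_perturb:
  assumes f: "f \<in> mspace circle_maps" and g: "g \<in> mspace circle_maps"
    and F: "degree_one F" "lifts F f" and near: "\<And>z. z \<in> circle \<Longrightarrow> dist (f z) (g z) < 1"
  obtains G where "degree_one G" "lifts G g"
proof
  define q where "q x = g (circ x) / f (circ x)" for x
  have fg: "continuous_on circle f" "continuous_on circle g"
    "norm (f (circ x)) = 1" "norm (g (circ x)) = 1" for x
    using f g circ_in_circle(1)[of x] unfolding mspace_circle_maps by (auto simp: Pi_iff)
  have f0: "f (circ x) \<noteq> 0" for x using fg(3)[of x] by force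
  have "continuous_on UNIV (\<lambda>x. f (circ x))" "continuous_on UNIV (\<lambda>x. g (circ x))"
    using fg(1,2)[THEN continuous_on_compose2, OF continuous_on_circ[OF continuous_on_id, of UNIV]]
      circ_in_circle(1) by blast+
  then have q: "continuous_on UNIV q" "norm (q x) = 1" for x
    unfolding q_def using fg(3,4) f0 by (simp_all add: continuous_on_divide norm_divide)
  have "norm (q x - 1) < 1" for x
  proof -
    have "q x - 1 = (g (circ x) - f (circ x)) / f (circ x)"
      using f0 by (simp add: q_def diff_divide_distrib)
    then show ?thesis
      using near[OF circ_in_circle(1), of x] fg(3)[of x] by (simp add: norm_divide dist_norm norm_minus_commute)
  qed
  then have "Re (q x) > 0" for x
    using abs_Re_le_cmod[of "q x - 1"] by (smt (verit) minus_complex.sel(1) one_complex.sel(1))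
  then have "q x \<notin> \<real>\<^sub>\<le>\<^sub>0" for x
    by (metis complex_nonpos_Reals_iff not_less)
  then have Arg: "continuous_on UNIV (\<lambda>x. Arg (q x))"
    using q(1) by (intro continuous_on_Arg') auto
  define G where "G x = F x + Arg (q x) / (2 * pi)" for x
  show "degree_one G"
    using F(1) Arg unfolding degree_one_def G_def by (auto intro!: continuous_intros simp: q_def)
  show "lifts G g"
    unfolding lifts_def
  proof
    fix x
    have "circ (G x) = f (circ x) * q x"
      using F(2) circ_Arg[of "q x"] q(2)[of x] by (force simp: G_def circ_add lifts_def)
    then show "g (circ x) = circ (G x)" using f0[of x] by (simp add: q_def)
  qed
qed

lemma Homeo_plus_circle_iff:
  "f \<in> carrier Homeo_plus_circle \<longleftrightarrow>
    f \<in> mspace circle_maps \<and> (\<exists>F. degree_one F \<and> lifts F f) \<and> inj_on f circle"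
proof
  assume f: "f \<in> carrier Homeo_plus_circle"
  have "f \<in> mspace circle_maps" using f Homeo_subset_circle_maps by (rule subsetD[rotated])
  moreover have "\<exists>F. degree_one F \<and> lifts F f" using f unfolding carrier_Homeo_plus_circle by blast
  ultimately show "f \<in> mspace circle_maps \<and> (\<exists>F. degree_one F \<and> lifts F f) \<and> inj_on f circle"
    using Homeo_plus_circle_props(3)[OF f] by simp
next
  assume f: "f \<in> mspace circle_maps \<and> (\<exists>F. degree_one F \<and> lifts F f) \<and> inj_on f circle"
  then obtain F where F: "degree_one F" "lifts F f" by metis
  have "strict_mono F" using degree_one_lift_inj_strict_mono[OF F] f by metis
  then show "f \<in> carrier Homeo_plus_circle"
    using F conjunct1[OF f] unfolding carrier_Homeo_plus_circle mspace_circle_maps by metis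
qed

lemma gdelta_in_Homeo_plus_circle: "gdelta_in (mtopology_of circle_maps) (carrier Homeo_plus_circle)"
proof -
  define A where "A = {f \<in> mspace circle_maps. \<exists>F. degree_one F \<and> lifts F f}"
  \<comment> \<open>Injectivity is tested only on pairs at distance at least
    \<open>1 / (n + 1)\<close>. These pairs form a compact set, which makes the condition open; all
    \<open>n\<close> together give injectivity.\<close>
  define B where "B n = {f \<in> mspace circle_maps.
      \<forall>z\<in>circle. \<forall>w\<in>circle. 1 / real (Suc n) \<le> dist z w \<longrightarrow> f z \<noteq> f w}" for n
  have "openin (mtopology_of circle_maps) A"
    unfolding openin_circle_maps
  proof (intro conjI ballI)
    show "A \<subseteq> mspace circle_maps" unfolding A_def by blast
    fix f assume "f \<in> A"
    then obtain F where F: "f \<in> mspace circle_maps" "degree_one F" "lifts F f" unfolding A_def by blast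
    have "g \<in> A" if "g \<in> mspace circle_maps" "\<forall>z\<in>circle. dist (f z) (g z) < 1" for g
      using degree_one_lift_perturb[OF F(1) that(1) F(2,3)] that unfolding A_def by blast
    then show "\<exists>r>0. \<forall>g\<in>mspace circle_maps. (\<forall>z\<in>circle. dist (f z) (g z) < r) \<longrightarrow> g \<in> A"
      by (intro exI[of _ 1]) auto
  qed
  moreover have "openin (mtopology_of circle_maps) (B n)" for n
    unfolding openin_circle_maps
  proof (intro conjI ballI)
    show "B n \<subseteq> mspace circle_maps" unfolding B_def by blast
    fix f assume f: "f \<in> B n"
    then have fC: "f \<in> mspace circle_maps" unfolding B_def by blast
    define K where "K = (circle \<times> circle) \<inter> {p. 1 / real (Suc n) \<le> dist (fst p) (snd p)}"
    have "closed {p :: complex \<times> complex. 1 / real (Suc n) \<le> dist (fst p) (snd p)}"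
      by (intro closed_Collect_le continuous_intros)
    then have K: "compact K" unfolding K_def by (intro compact_Int_closed compact_Times compact_sphere)
    have cf: "continuous_on circle f" using fC unfolding mspace_circle_maps by blast
    have cont: "continuous_on K (\<lambda>p. dist (f (fst p)) (f (snd p)))"
      by (intro continuous_on_dist continuous_on_compose2[OF cf] continuous_on_fst continuous_on_snd continuous_on_id)
        (auto simp: K_def)
    \<comment> \<open>\<open>e\<close> is the least distance between the images of such a pair,
      positive because the minimum is attained; if there are no pairs, 1 serves.\<close>
    obtain e where e: "e > 0" "\<And>p. p \<in> K \<Longrightarrow> e \<le> dist (f (fst p)) (f (snd p))"
    proof (cases "K = {}")
      case True then show thesis using that[of 1] by simp
    next
      case False
      then obtain p where p: "p \<in> K" "\<forall>q\<in>K. dist (f (fst p)) (f (snd p)) \<le> dist (f (fst q)) (f (snd q))"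
        using continuous_attains_inf[OF K _ cont] by blast
      then have "f (fst p) \<noteq> f (snd p)" using f unfolding B_def K_def by auto
      then show thesis using p that[of "dist (f (fst p)) (f (snd p))"] by simp
    qed
    have "g \<in> B n" if g: "g \<in> mspace circle_maps" "\<forall>z\<in>circle. dist (f z) (g z) < e / 2" for g
      unfolding B_def
    proof (intro CollectI conjI ballI impI g(1))
      fix z w assume zw: "z \<in> circle" "w \<in> circle" "1 / real (Suc n) \<le> dist z w"
      then have "e \<le> dist (f z) (f w)" using e(2)[of "(z, w)"] by (simp add: K_def)
      moreover have "dist (f z) (g z) < e / 2" "dist (f w) (g w) < e / 2" using g(2) zw by blast+
      ultimately show "g z \<noteq> g w" by metric
    qed
    then show "\<exists>r>0. \<forall>g\<in>mspace circle_maps. (\<forall>z\<in>circle. dist (f z) (g z) < r) \<longrightarrow> g \<in> B n"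
      using e(1) by (intro exI[of _ "e / 2"]) simp
  qed
  moreover have "carrier Homeo_plus_circle = A \<inter> (\<Inter>n. B n)"
  proof (intro equalityI subsetI)
    fix f assume f: "f \<in> carrier Homeo_plus_circle"
    then have "f \<in> A" unfolding Homeo_plus_circle_iff A_def by blast
    moreover have "f \<in> B n" for n
      unfolding B_def
    proof (intro CollectI conjI ballI impI)
      show "f \<in> mspace circle_maps" using f unfolding Homeo_plus_circle_iff by blast
      fix z w :: complex assume "z \<in> circle" "w \<in> circle" "1 / real (Suc n) \<le> dist z w"
      moreover from this(3) have "z \<noteq> w" by (auto simp: divide_le_0_iff)
      ultimately show "f z \<noteq> f w" using Homeo_plus_circle_props(3)[OF f] by (simp add: inj_on_eq_iff)
    qed
    ultimately show "f \<in> A \<inter> (\<Inter>n. B n)" by blast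
  next
    fix f assume f: "f \<in> A \<inter> (\<Inter>n. B n)"
    have "inj_on f circle"
    proof (rule inj_onI, rule ccontr)
      fix z w assume zw: "z \<in> circle" "w \<in> circle" "f z = f w" "z \<noteq> w"
      then have "dist z w > 0" by simp
      then obtain n where "1 / real (Suc n) < dist z w" by (rule nat_approx_posE)
      moreover have "f \<in> B n" using f by blast
      ultimately show False using zw unfolding B_def by auto
    qed
    then show "f \<in> carrier Homeo_plus_circle" using f unfolding Homeo_plus_circle_iff A_def by blast
  qed
  moreover from calculation(2) have "gdelta_in (mtopology_of circle_maps) (\<Inter>n. B n)"
    by (intro gdelta_in_Inter) (auto intro: open_imp_gdelta_in simp del: mspace_cfunspace)
  ultimately show ?thesis
    by (simp only: gdelta_in_Int open_imp_gdelta_in)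
qed

lemma Polish_group_Homeo_plus_circle: "Polish_group Homeo_plus_circle Homeo_plus_circle_topology"
proof -
  interpret m: Metric_space circle "dist :: complex \<Rightarrow> complex \<Rightarrow> real"
    by (rule Metric_space.subspace[OF Met_TC.Metric_space_axioms]) simp
  have Self: "m.Self = circle_metric"
    by (simp add: m.Self_def submetric_def)
  \<comment> \<open>The circle is complete because it is compact. Completeness passes to the maps
    into it, and complete metrizability to the G-delta subset formed by the group.\<close>
  have "m.mcomplete"
    using compact_space_circle
    unfolding mtopology_of_circle_metric[symmetric] Self[symmetric] mtopology_of_def m.mspace_Self m.mdist_Self
    by (rule m.compact_space_imp_mcomplete)
  then have "mcomplete_of circle_maps"
    by (rule m.mcomplete_cfunspace[of "top_of_set circle", unfolded Self])
  then have "completely_metrizable_space (mtopology_of circle_maps)"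
    unfolding mcomplete_of_def mtopology_of_def
    by (rule Metric_space.completely_metrizable_space_mtopology[OF Metric_space_mspace_mdist])
  then have "completely_metrizable_space Homeo_plus_circle_topology"
    unfolding Homeo_plus_circle_topology_eq
    using gdelta_in_Homeo_plus_circle by (rule completely_metrizable_space_gdelta_in)
  then show ?thesis
    unfolding Polish_group_def Polish_space_def
    using topological_group_Homeo_plus_circle separable_Homeo_plus_circle by blast
qed

lemma not_extremely_amenable_Homeo_plus_circle:
  "\<not> extremely_amenable TYPE(complex) Homeo_plus_circle Homeo_plus_circle_topology"
proof -
  let ?Y = "top_of_set circle"
  have "group_action Homeo_plus_circle circle (\<lambda>g. g)"
    unfolding group_action_def group_hom_def group_hom_axioms_def
    using group_Homeo_plus_circle group_BijGroup Homeo_plus_circle_props(1)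
    by (auto simp: hom_def BijGroup_def Homeo_plus_circle_mult)
  then have "compact_G_space Homeo_plus_circle Homeo_plus_circle_topology ?Y (\<lambda>g. g)"
    unfolding compact_G_space_def
    using compact_space_circle continuous_map_Homeo_action
    by (simp add: Hausdorff_space_subtopology)
  moreover have "\<not> has_fixed_point Homeo_plus_circle ?Y (\<lambda>g. g)"
  proof
    assume "has_fixed_point Homeo_plus_circle ?Y (\<lambda>g. g)"
    then obtain z where z: "z \<in> circle" "\<And>g. g \<in> carrier Homeo_plus_circle \<Longrightarrow> g z = z"
      unfolding has_fixed_point_def by auto
    \<comment> \<open>The half turn alone already moves every point.\<close>
    define g where "g = (\<lambda>z\<in>circle. - z)"
    have "lifts (\<lambda>x. x + 1/2) g"
      unfolding lifts_def g_def by (simp add: circ_add) (simp add: circ_def)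
    moreover have "degree_one (\<lambda>x. x + 1/2)" "strict_mono (\<lambda>x::real. x + 1/2)"
      by (auto simp: degree_one_def strict_mono_def intro!: continuous_intros)
    ultimately have "g \<in> carrier Homeo_plus_circle"
      unfolding carrier_Homeo_plus_circle g_def by blast
    then have "g z = z" by (rule z(2))
    then show False using z(1) by (auto simp: g_def)
  qed
  ultimately show ?thesis unfolding extremely_amenable_def by blast
qed

section \<open>Homeomorphisms fixing a point\<close>

text \<open>\<open>f\<close> is computed from an arbitrarily chosen preimage under
  \<open>circ\<close>. Another choice differs by an integer, which \<open>F\<close> carries over to
  its values and \<open>circ\<close> erases.\<close>

lemma degree_one_realization:
  assumes F: "degree_one F" "strict_mono F"
  obtains f where "f \<in> carrier Homeo_plus_circle" "lifts F f"
proof -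
  define f where "f = (\<lambda>z\<in>circle. circ (F (SOME x. z = circ x)))"
  have "f (circ x) = circ (F x)" for x
  proof -
    have "circ x = circ (SOME y. circ x = circ y)" by (rule someI[of _ x]) simp
    then obtain k :: int where "(SOME y. circ x = circ y) = x + of_int k"
      using circ_eq_iff by metis
    then show ?thesis by (simp add: f_def degree_one_of_int[OF F(1)])
  qed
  then have "lifts F f" by (simp add: lifts_def)
  moreover have "f \<in> extensional circle" unfolding f_def by (rule restrict_extensional)
  ultimately show thesis using that F unfolding carrier_Homeo_plus_circle by blast
qed

text \<open>A homeomorphism in the stabilizer of the point 1 becomes such a map when the circle is
  cut open there. Nothing is asked of \<open>p\<close> outside the unit interval.\<close>

definition interval_homeo :: "(real \<Rightarrow> real) \<Rightarrow> bool"
  where "interval_homeo p \<longleftrightarrow> continuous_on {0..1} p \<and> strict_mono_on {0..1} p \<and> p 0 = 0 \<and> p 1 = 1"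

lemma interval_homeo_less_iff:
  assumes "interval_homeo p" "x \<in> {0..1}" "y \<in> {0..1}"
  shows "p x < p y \<longleftrightarrow> x < y"
  using assms strict_mono_onD[of "{0..1}" p] unfolding interval_homeo_def
  by (metis linorder_less_linear order_less_asym)

lemma interval_homeo_le_iff:
  assumes "interval_homeo p" "x \<in> {0..1}" "y \<in> {0..1}"
  shows "p x \<le> p y \<longleftrightarrow> x \<le> y"
  using interval_homeo_less_iff[OF assms(1,3,2)] by (metis not_less)

lemma interval_homeo_mem:
  assumes "interval_homeo p" "x \<in> {0..1}"
  shows "p x \<in> {0..1}"
proof -
  have "p 0 = 0" "p 1 = 1" using assms(1) by (auto simp: interval_homeo_def)
  then show ?thesis
    using interval_homeo_le_iff[OF assms(1), of 0 x] interval_homeo_le_iff[OF assms(1), of x 1] assms(2) by simp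
qed

lemma interval_homeo_surj:
  assumes "interval_homeo p" "y \<in> {0..1}"
  obtains x where "x \<in> {0..1}" "p x = y"
  using IVT'[of p 0 y 1] assms unfolding interval_homeo_def by auto

definition extends_interval :: "(real \<Rightarrow> real) \<Rightarrow> (complex \<Rightarrow> complex) \<Rightarrow> bool"
  where "extends_interval p f \<longleftrightarrow> (\<forall>x\<in>{0..1}. f (circ x) = circ (p x))"

text \<open>\<open>p\<close> is continued to the line by the integer part. The continuation is
  increasing and onto, so it is continuous without a separate gluing argument at the
  integers.\<close>

lemma interval_homeo_realization:
  assumes p: "interval_homeo p"
  obtains f where "f \<in> carrier Homeo_plus_circle" "extends_interval p f"
proof -
  define F where "F x = p (frac x) + of_int \<lfloor>x\<rfloor>" for x
  have frac: "frac x \<in> {0..1}" for x :: real by (simp add: frac_lt_1 less_imp_le)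
  have p01: "p 0 = 0" "p 1 = 1" using p by (auto simp: interval_homeo_def)
  have lt1: "p (frac x) < 1" for x
    using interval_homeo_less_iff[OF p frac, of 1 x] p01 frac_lt_1[of x] by simp
  have ge0: "0 \<le> p (frac x)" for x using interval_homeo_mem[OF p frac] by simp
  have mono: "strict_mono F"
  proof (rule strict_monoI)
    fix x y :: real assume xy: "x < y"
    then consider "\<lfloor>x\<rfloor> = \<lfloor>y\<rfloor>" | "\<lfloor>x\<rfloor> + 1 \<le> \<lfloor>y\<rfloor>" using floor_mono[of x y] by linarith
    then show "F x < F y"
    proof cases
      case 1
      then have "frac x < frac y" using xy by (simp add: frac_def)
      then show ?thesis using 1 interval_homeo_less_iff[OF p frac frac] by (simp add: F_def)
    next
      case 2
      then have "real_of_int \<lfloor>x\<rfloor> + 1 \<le> of_int \<lfloor>y\<rfloor>" by linarith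
      then show ?thesis using lt1[of x] ge0[of y] unfolding F_def by linarith
    qed
  qed
  have "\<exists>x. F x = y" for y
  proof -
    obtain t where t: "t \<in> {0..1}" "p t = frac y" using interval_homeo_surj[OF p frac] .
    have "t \<noteq> 1" using t p01 frac_lt_1[of y] by auto
    then have t1: "0 \<le> t" "t < 1" using t by auto
    have "\<lfloor>t + of_int \<lfloor>y\<rfloor>\<rfloor> = \<lfloor>y\<rfloor>" using t1 by linarith
    then have "F (t + of_int \<lfloor>y\<rfloor>) = y" using t by (simp add: F_def frac_def)
    then show ?thesis by blast
  qed
  then have "range F = UNIV" by (metis surj_def)
  then have "continuous_on UNIV F"
    using mono by (intro continuous_onI_mono) (auto simp: strict_mono_less_eq)
  then have "degree_one F" by (simp add: degree_one_def F_def frac_1_eq)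
  then obtain f where f: "f \<in> carrier Homeo_plus_circle" "lifts F f"
    using mono by (rule degree_one_realization)
  have "extends_interval p f"
    unfolding extends_interval_def
  proof
    fix x :: real assume x: "x \<in> {0..1}"
    show "f (circ x) = circ (p x)"
    \<comment> \<open>At the right end the fractional part is 0, so the value comes from
      \<open>p 0\<close>; it agrees because both ends map to the point 1 of the circle.\<close>
    proof (cases "x = 1")
      case True
      then show ?thesis using f(2)[unfolded lifts_def, rule_format, of 0] p01 by (simp add: F_def)
    next
      case False
      then have "\<lfloor>x\<rfloor> = 0" using x by (simp add: floor_eq_iff)
      then show ?thesis using f(2) by (simp add: lifts_def F_def frac_def)
    qed
  qed
  with f(1) show thesis by (rule that)
qed

lemma interval_homeo_of_fixed:
  assumes f: "f \<in> carrier Homeo_plus_circle" "f 1 = 1"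
  obtains p where "interval_homeo p" "extends_interval p f"
proof -
  obtain F where F: "degree_one F" "strict_mono F" "lifts F f"
    using f(1) unfolding carrier_Homeo_plus_circle by blast
  have "circ (F 0) = circ 0" using F(3)[unfolded lifts_def, rule_format, of 0] f(2) by simp
  then obtain k :: int where k: "F 0 = of_int k" unfolding circ_eq_iff by auto
  define p where "p x = F x - of_int k" for x
  have "F 1 = F 0 + 1" using degree_one_of_int[OF F(1), of 0 1] by simp
  then have "interval_homeo p"
    using F(1,2) k unfolding interval_homeo_def p_def degree_one_def
    by (auto simp: strict_mono_on_def strict_mono_def intro!: continuous_intros intro: continuous_on_subset)
  moreover have "extends_interval p f"
    using F(3) by (simp add: extends_interval_def p_def lifts_def circ_diff)
  ultimately show thesis by (rule that)
qed

text \<open>A chord is at most as long as its arc: after a rotation that takes one end to 1, the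
  chord is twice a sine.\<close>

lemma dist_circ: "dist (circ x) (circ y) \<le> 2 * pi * \<bar>x - y\<bar>"
proof -
  have "circ x - circ y = circ y * (circ (x - y) - 1)"
    by (simp add: circ_diff right_diff_distrib)
  then have "dist (circ x) (circ y) = norm (exp (\<i> * of_real (2 * pi * (x - y))) - 1)"
    by (simp add: dist_norm norm_mult circ_def cis_conv_exp)
  also have "\<dots> = 2 * \<bar>sin (2 * pi * (x - y) / 2)\<bar>"
    using dist_exp_i_1 by blast
  also have "\<dots> \<le> 2 * \<bar>2 * pi * (x - y) / 2\<bar>"
    using abs_sin_x_le_abs_x by (intro mult_left_mono) auto
  also have "\<dots> = 2 * pi * \<bar>x - y\<bar>" by (simp add: abs_mult)
  finally show ?thesis .
qed

text \<open>Multiplication of the odds \<open>x / (1 - x)\<close> by \<open>a\<close>.\<close>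

definition odds_scale :: "real \<Rightarrow> real \<Rightarrow> real"
  where "odds_scale a x = a * x / (1 - x + a * x)"

lemma odds_scale_denom_pos:
  fixes a x :: real
  assumes "a > 0" "x \<in> {0..1}"
  shows "1 - x + a * x > 0"
proof (cases "x = 1")
  case False
  then have "1 - x > 0" "a * x \<ge> 0" using assms by auto
  then show ?thesis by linarith
qed (use assms in simp)

lemma interval_homeo_odds_scale:
  assumes a: "a > 0"
  shows "interval_homeo (odds_scale a)"
  unfolding interval_homeo_def
proof (intro conjI)
  show "continuous_on {0..1} (odds_scale a)"
    unfolding odds_scale_def
    using odds_scale_denom_pos[OF a] by (intro continuous_intros) (metis less_irrefl)
  show "strict_mono_on {0..1} (odds_scale a)"
  proof (rule strict_mono_onI)
    fix x y :: real assume xy: "x \<in> {0..1}" "y \<in> {0..1}" "x < y"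
    have "a * y * (1 - x + a * x) - a * x * (1 - y + a * y) = a * (y - x)"
      by (simp add: algebra_simps)
    also have "\<dots> > 0" using a xy by simp
    finally have "a * x * (1 - y + a * y) < a * y * (1 - x + a * x)" by simp
    then show "odds_scale a x < odds_scale a y"
      unfolding odds_scale_def using odds_scale_denom_pos[OF a xy(1)] odds_scale_denom_pos[OF a xy(2)]
      by (simp only: pos_divide_less_eq pos_less_divide_eq times_divide_eq_left)
  qed
qed (use a in \<open>simp_all add: odds_scale_def\<close>)

lemma odds_scale_transitive:
  assumes x: "0 < x" "x < 1" and y: "0 < y" "y < 1"
  obtains a where "a > 0" "odds_scale a x = y"
proof
  \<comment> \<open>The quotient of the odds of \<open>y\<close> by the odds of
    \<open>x\<close>.\<close>
  let ?a = "y * (1 - x) / (x * (1 - y))"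
  show "?a > 0" using assms by simp
  have "?a * x = y * (1 - x) / (1 - y)" using x by simp
  moreover have "1 - x + y * (1 - x) / (1 - y) = (1 - x) / (1 - y)"
    using y by (simp add: field_simps)
  ultimately show "odds_scale ?a x = y"
    using assms by (simp add: odds_scale_def)
qed

text \<open>For small \<open>a\<close>, \<open>odds_scale a\<close> sends all but a short interval
  ending at 1 below \<eta>, where \<open>h\<close> is the identity. So the conjugate of
  \<open>h\<close> moves only points of that short interval, and keeps them in it.\<close>

lemma extends_interval_odds_scale_conj_close:
  assumes h: "h \<in> carrier Homeo_plus_circle" "interval_homeo q" "extends_interval q h"
    and eta: "0 < \<eta>" "\<eta> < 1" "\<And>x. 0 \<le> x \<Longrightarrow> x \<le> \<eta> \<Longrightarrow> q x = x"
    and g: "g \<in> carrier Homeo_plus_circle" "extends_interval (odds_scale a) g"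
    and a: "0 < a" "a * 2 * pi < r * \<eta>"
    and z: "z \<in> circle"
  shows "dist z ((inv\<^bsub>Homeo_plus_circle\<^esub> g \<otimes>\<^bsub>Homeo_plus_circle\<^esub> (h \<otimes>\<^bsub>Homeo_plus_circle\<^esub> g)) z) < r"
proof -
  interpret group Homeo_plus_circle by (rule group_Homeo_plus_circle)
  let ?m = "odds_scale a"
  note m = interval_homeo_odds_scale[OF a(1)]
  obtain x where x: "0 \<le> x" "x < 1" "z = circ x" using z by (rule circ_surj)
  then have xI: "x \<in> {0..1}" by simp
  \<comment> \<open>\<open>y\<close> is the coordinate of the image of \<open>z\<close> under the
    conjugate.\<close>
  obtain y where y: "y \<in> {0..1}" "?m y = q (?m x)"
    using interval_homeo_surj[OF m interval_homeo_mem[OF h(2) interval_homeo_mem[OF m xI]]] .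
  have "h (g (circ x)) = g (circ y)"
    using h(3) g(2) y xI interval_homeo_mem[OF m xI] unfolding extends_interval_def by metis
  then have eq: "(inv\<^bsub>Homeo_plus_circle\<^esub> g \<otimes>\<^bsub>Homeo_plus_circle\<^esub> (h \<otimes>\<^bsub>Homeo_plus_circle\<^esub> g)) z = circ y"
    using h(1) g(1) z x(3) Homeo_plus_circle_props(6)
    by (simp add: Homeo_plus_circle_mult_apply Homeo_plus_circle_inv_apply(2) del: mem_sphere_0 mem_sphere)
  have "2 * pi * \<bar>x - y\<bar> < r"
  proof (cases "?m x \<le> \<eta>")
    case True
    then have "?m y = ?m x" using y eta(3) interval_homeo_mem[OF m xI] by simp
    then have "y = x"
      using interval_homeo_le_iff[OF m xI y(1)] interval_homeo_le_iff[OF m y(1) xI] by simp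
    moreover have "r * \<eta> > 0" using a pi_gt_zero by (smt (verit) mult_pos_pos)
    then have "r > 0" using eta by (simp add: zero_less_mult_iff)
    ultimately show ?thesis by simp
  next
    case False
    \<comment> \<open>Clearing the denominator in \<eta> \<le> \<open>?m w\<close> bounds \<eta>
      times \<open>1 - w\<close> by \<open>a\<close>. The term \<eta> times \<open>a * w\<close>,
      positive since \<open>w\<close> is not 0, makes the bound strict.\<close>
    have near1: "1 - w < a / \<eta>" if w: "w \<in> {0..1}" "\<eta> \<le> ?m w" for w
    proof -
      have "\<eta> * (1 - w + a * w) \<le> a * w"
        using w(2) odds_scale_denom_pos[OF a(1) w(1)] by (simp add: odds_scale_def pos_le_divide_eq)
      moreover have "a * w \<le> a" "\<eta> * (a * w) \<ge> 0" using w(1) a eta by (auto simp: mult_left_le)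
      moreover have "w > 0"
      proof (rule ccontr)
        assume "\<not> w > 0"
        then have "w = 0" using w(1) by simp
        then show False using w(2) eta(1) by (simp add: odds_scale_def)
      qed
      then have "\<eta> * (a * w) > 0" using a eta by simp
      ultimately have "\<eta> * (1 - w) < a" by (simp add: distrib_left)
      then show ?thesis using eta(1) by (simp add: pos_less_divide_eq mult.commute)
    qed
    \<comment> \<open>\<open>q\<close> fixes \<eta> and is increasing, so \<open>?m y\<close> also
      stays above \<eta>, and \<open>y\<close> is as near to 1 as \<open>x\<close>.\<close>
    have "\<eta> = q \<eta>" using eta by simp
    also have "\<dots> \<le> q (?m x)"
      using interval_homeo_le_iff[OF h(2), of \<eta> "?m x"] False eta interval_homeo_mem[OF m xI] by simp
    finally have "\<eta> \<le> ?m y" using y by simp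
    then have "1 - y < a / \<eta>" "1 - x < a / \<eta>" using near1 y(1) xI False by auto
    then have "\<bar>x - y\<bar> < a / \<eta>" using xI y(1) by auto
    then have "2 * pi * \<bar>x - y\<bar> < 2 * pi * (a / \<eta>)" by (intro mult_strict_left_mono) simp_all
    also have "\<dots> < r" using a(2) eta(1) by (simp add: field_simps)
    finally show ?thesis .
  qed
  then show ?thesis using dist_circ[of x y] x(3) eq by simp
qed

text \<open>The approximation is \<open>h\<close> squeezed into the interval from \<open>\<eta>\<close> to \<open>1\<close>.\<close>

lemma approx_identity_near_0:
  assumes h: "h \<in> carrier Homeo_plus_circle" "h 1 = 1" and r: "r > 0"
  obtains k q \<eta> where "k \<in> carrier Homeo_plus_circle" "interval_homeo q" "extends_interval q k"
    "0 < \<eta>" "\<eta> < 1" "\<And>x. 0 \<le> x \<Longrightarrow> x \<le> \<eta> \<Longrightarrow> q x = x"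
    "\<And>z. z \<in> circle \<Longrightarrow> dist (h z) (k z) < r"
proof -
  obtain p where p: "interval_homeo p" "extends_interval p h"
    using interval_homeo_of_fixed[OF h] .
  have p01: "p 0 = 0" "p 1 = 1" using p by (auto simp: interval_homeo_def)
  \<comment> \<open>Coordinates will differ by less than \<open>2 * e\<close>, which gives a
    distance below two thirds of \<open>r\<close> on the circle.\<close>
  define e where "e = r / (6 * pi)"
  have e: "e > 0" using r by (simp add: e_def)
  have "uniformly_continuous_on {0..1} p"
    using p(1) by (intro compact_uniformly_continuous) (auto simp: interval_homeo_def)
  then obtain d where d: "d > 0" "\<forall>x\<in>{0..1}. \<forall>y\<in>{0..1}. dist y x < d \<longrightarrow> dist (p y) (p x) < e"
    using e unfolding uniformly_continuous_on_def by metis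
  \<comment> \<open>Below \<open>d\<close> for uniform continuity of \<open>p\<close>, at most
    \<open>e\<close> for the linear terms, and below 1 so that an interval remains for the squeezed
    map.\<close>
  define \<eta> where "\<eta> = Min {d / 2, e, 1 / 2}"
  have eta: "0 < \<eta>" "\<eta> < 1" "\<eta> < d" "\<eta> \<le> e" using d(1) e by (auto simp: \<eta>_def min_def)
  \<comment> \<open>\<open>m\<close> collapses the interval from 0 to \<eta> to the point 0 and
    stretches the rest onto the unit interval. Thus \<open>q\<close> is the identity up to \<eta>,
    and beyond it an affine copy of \<open>p\<close>.\<close>
  define m where "m x = max 0 ((x - \<eta>) / (1 - \<eta>))" for x
  define q where "q x = (1 - \<eta>) * p (m x) + min x \<eta>" for x
  have mI: "m x \<in> {0..1}" if "x \<in> {0..1}" for x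
    using that eta by (auto simp: m_def field_simps)
  have m_mono: "m x \<le> m y" if "x \<le> y" for x y
    using that eta unfolding m_def by (intro max.mono divide_right_mono) auto
  have mx: "\<bar>m x - x\<bar> \<le> \<eta>" if x: "x \<in> {0..1}" for x
  proof (cases "x \<le> \<eta>")
    case True
    then have "(x - \<eta>) / (1 - \<eta>) \<le> 0" using eta by (simp add: divide_le_0_iff)
    then show ?thesis using True x by (simp add: m_def)
  next
    case False
    then have "m x = (x - \<eta>) / (1 - \<eta>)" using eta by (simp add: m_def)
    then have "(1 - \<eta>) * m x = x - \<eta>" using eta by simp
    then have "(1 - \<eta>) * (x - m x) = \<eta> * (1 - x)" by (simp add: algebra_simps)
    moreover have "\<eta> * (1 - x) \<le> \<eta> * (1 - \<eta>)" "\<eta> * (1 - x) \<ge> 0" using False eta x by auto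
    ultimately have "(1 - \<eta>) * (x - m x) \<le> (1 - \<eta>) * \<eta>" "(1 - \<eta>) * (x - m x) \<ge> 0"
      by (simp_all add: mult.commute)
    then show ?thesis using eta by (simp add: mult_le_cancel_left zero_le_mult_iff)
  qed
  have cm: "continuous_on {0..1} m"
    unfolding m_def using eta by (intro continuous_on_max continuous_intros) auto
  have cp: "continuous_on {0..1} p" using p(1) unfolding interval_homeo_def by (rule conjunct1)
  have "m ` {0..1} \<subseteq> {0..1}" using mI by blast
  then have "continuous_on {0..1} (\<lambda>x. p (m x))" by (rule continuous_on_compose2[OF cp cm])
  then have "continuous_on {0..1} q"
    unfolding q_def by (intro continuous_on_add continuous_on_mult_left continuous_on_min continuous_on_id continuous_on_const)
  moreover have "strict_mono_on {0..1} q"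
  proof (rule strict_mono_onI)
    fix x y :: real assume xy: "x \<in> {0..1}" "y \<in> {0..1}" "x < y"
    have le: "p (m x) \<le> p (m y)"
      using interval_homeo_le_iff[OF p(1) mI[OF xy(1)] mI[OF xy(2)]] m_mono[of x y] xy(3) by simp
    show "q x < q y"
    \<comment> \<open>Left of \<eta> strictness comes from the term \<open>min x \<eta>\<close>,
      right of it from \<open>p\<close> and \<open>m\<close>.\<close>
    proof (cases "x < \<eta>")
      case True
      then have "min x \<eta> < min y \<eta>" using xy by simp
      moreover have "(1 - \<eta>) * p (m x) \<le> (1 - \<eta>) * p (m y)" using le eta by (intro mult_left_mono) auto
      ultimately show ?thesis unfolding q_def by linarith
    next
      case False
      then have "m x < m y" using xy eta by (simp add: m_def divide_strict_right_mono max_def)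
      then have "p (m x) < p (m y)"
        using interval_homeo_less_iff[OF p(1) mI[OF xy(1)] mI[OF xy(2)]] by simp
      then show ?thesis using eta False xy by (simp add: q_def)
    qed
  qed
  moreover have "m 0 = 0" "m 1 = 1" using eta by (simp_all add: m_def divide_le_0_iff max_def)
  then have "q 0 = 0" "q 1 = 1" using eta p01 by (simp_all add: q_def)
  ultimately have q: "interval_homeo q" unfolding interval_homeo_def by simp
  obtain k where k: "k \<in> carrier Homeo_plus_circle" "extends_interval q k"
    using interval_homeo_realization[OF q] .
  have "q x = x" if "0 \<le> x" "x \<le> \<eta>" for x
  proof -
    have "(x - \<eta>) / (1 - \<eta>) \<le> 0" using that eta by (simp add: divide_le_0_iff)
    then have "m x = 0" by (simp add: m_def)
    then show ?thesis using that p01 by (simp add: q_def)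
  qed
  moreover have "dist (h z) (k z) < r" if z: "z \<in> circle" for z
  proof -
    obtain x where x: "0 \<le> x" "x < 1" "z = circ x" by (rule circ_surj[OF z])
    then have xI: "x \<in> {0..1}" by simp
    have "dist (h z) (k z) \<le> 2 * pi * \<bar>p x - q x\<bar>"
      using dist_circ p(2) k(2) xI x(3) unfolding extends_interval_def by metis
    moreover have "\<bar>p x - p (m x)\<bar> < e"
      using d(2) xI mI[OF xI] mx[OF xI] eta(3) unfolding dist_real_def by (metis abs_minus_commute order_le_less_trans)
    \<comment> \<open>The first difference is below \<open>e\<close> by uniform continuity. The
      other two terms both lie between 0 and \<eta>, so their difference is at most \<open>e\<close>
      in absolute value.\<close>
    moreover have "p x - q x = (p x - p (m x)) + \<eta> * p (m x) - min x \<eta>"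
      by (simp add: q_def algebra_simps)
    moreover have "0 \<le> \<eta> * p (m x)" "\<eta> * p (m x) \<le> \<eta>"
      using interval_homeo_mem[OF p(1) mI[OF xI]] eta by (auto simp: mult_left_le)
    moreover have "0 \<le> min x \<eta>" "min x \<eta> \<le> \<eta>" using x eta by auto
    ultimately have *: "dist (h z) (k z) \<le> 2 * pi * \<bar>p x - q x\<bar>" "\<bar>p x - q x\<bar> < 2 * e"
      using eta(4) by linarith+
    have "2 * pi * \<bar>p x - q x\<bar> < 2 * pi * (2 * e)" using *(2) by simp
    also have "\<dots> < r" using r by (simp add: e_def)
    finally show ?thesis using *(1) by simp
  qed
  ultimately show thesis using that k q eta(1,2) by blast
qed

section \<open>Fixed points of SUC actions\<close>

text \<open>The diagonal is closed and the square is regular, so an open box around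
  \<open>(p, q)\<close> misses a neighborhood of the diagonal, which serves as the entourage. This
  turns a failure of fixedness into something that approximations contradict.\<close>

lemma the_uniformity_separates:
  assumes Y: "compact_space Y" "Hausdorff_space Y" and pq: "p \<in> topspace Y" "q \<in> topspace Y" "p \<noteq> q"
  obtains E A B where "E \<in> the_uniformity Y" "openin Y A" "openin Y B" "p \<in> A" "q \<in> B"
    "\<And>a b. a \<in> A \<Longrightarrow> b \<in> B \<Longrightarrow> (a, b) \<notin> E"
proof -
  let ?D = "(\<lambda>y. (y, y)) ` topspace Y"
  have reg: "regular_space (prod_topology Y Y)"
    using Y compact_Hausdorff_imp_regular_space regular_space_prod_topology by blast
  have cl: "closedin (prod_topology Y Y) ?D"
    using Y(2) Hausdorff_space_closedin_diagonal by blast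
  have "(p, q) \<in> topspace (prod_topology Y Y) - ?D" using pq by auto
  then obtain U V where UV: "openin (prod_topology Y Y) U" "openin (prod_topology Y Y) V"
      "(p, q) \<in> U" "?D \<subseteq> V" "disjnt U V"
    using reg[unfolded regular_space_def, rule_format, OF conjI[OF cl]] by metis
  obtain A B where AB: "openin Y A" "openin Y B" "p \<in> A" "q \<in> B" "A \<times> B \<subseteq> U"
    using UV(1,3) unfolding openin_prod_topology_alt by meson
  have "Id_on (topspace Y) \<subseteq> V" using UV(4) by (auto simp: Id_on_def)
  then have "V \<in> diagonal_nhds Y"
    using UV(2) openin_subset[OF UV(2)] by (intro diagonal_nhdsI[of Y V]) simp_all
  then have "V \<in> the_uniformity Y" using the_uniformity_eq[OF Y] by simp
  moreover have "(a, b) \<notin> V" if "a \<in> A" "b \<in> B" for a b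
    using that AB(5) UV(5) by (auto simp: disjnt_iff)
  ultimately show thesis using that AB(1-4) by blast
qed

lemma compact_space_cluster_point:
  fixes x :: "nat \<Rightarrow> 'a"
  assumes Y: "compact_space Y" and x: "\<And>n. x n \<in> topspace Y"
  obtains y where "y \<in> topspace Y" "\<And>A N. openin Y A \<Longrightarrow> y \<in> A \<Longrightarrow> \<exists>n\<ge>N. x n \<in> A"
proof (rule ccontr)
  assume "\<not> thesis"
  then have "\<exists>A N. openin Y A \<and> y \<in> A \<and> (\<forall>n\<ge>N. x n \<notin> A)" if "y \<in> topspace Y" for y
    using that \<open>\<And>y. y \<in> topspace Y \<Longrightarrow> (\<And>A N. openin Y A \<Longrightarrow> y \<in> A \<Longrightarrow> \<exists>n\<ge>N. x n \<in> A) \<Longrightarrow> thesis\<close>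
    by metis
  then obtain A N where AN: "\<And>y. y \<in> topspace Y \<Longrightarrow> openin Y (A y) \<and> y \<in> A y \<and> (\<forall>n\<ge>N y. x n \<notin> A y)"
    by metis
  obtain P where P: "finite P" "P \<subseteq> topspace Y" "topspace Y \<subseteq> \<Union>(A ` P)"
    using compact_space_pointwise_cover[OF Y, of A] AN by metis
  \<comment> \<open>The sum is a common bound for the finitely many thresholds, so
    \<open>x M\<close> avoids every set of a cover.\<close>
  define M where "M = (\<Sum>p\<in>P. N p)"
  obtain p where p: "p \<in> P" "x M \<in> A p" using P(3) x[of M] by blast
  have "N p \<le> M" unfolding M_def using P(1) p(1) by (rule member_le_sum[rotated -1]) simp_all
  then show False using AN p P(2) by blast
qed

lemma SUC_Homeo_plus_circle_fixed_point:
  assumes G: "compact_G_space Homeo_plus_circle Homeo_plus_circle_topology Y \<phi>"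
    and SUC: "SUC_G_space Homeo_plus_circle Homeo_plus_circle_topology Y \<phi>"
  shows "has_fixed_point Homeo_plus_circle Y \<phi>"
proof -
  let ?G = "carrier Homeo_plus_circle" and ?T = "Homeo_plus_circle_topology"
  let ?mult = "\<lambda>g h. g \<otimes>\<^bsub>Homeo_plus_circle\<^esub> h"
  interpret group Homeo_plus_circle by (rule group_Homeo_plus_circle)
  have Y: "topspace Y \<noteq> {}" "compact_space Y" "Hausdorff_space Y"
    and act: "group_action Homeo_plus_circle (topspace Y) \<phi>"
    and cont: "continuous_map (prod_topology ?T Y) Y (\<lambda>(g, y). \<phi> g y)"
    using G by (auto simp: compact_G_space_def)
  have in_Y: "\<phi> g y \<in> topspace Y" if "g \<in> ?G" "y \<in> topspace Y" for g y
    using group_action.element_image[OF act that refl] .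
  have comp: "\<phi> (?mult g h) y = \<phi> g (\<phi> h y)" if "g \<in> ?G" "h \<in> ?G" "y \<in> topspace Y" for g h y
    using group_action.composition_rule[OF act that(3,1,2)] .
  have cont_y: "continuous_map Y Y (\<phi> g)" if "g \<in> ?G" for g
  proof -
    have "continuous_map Y (prod_topology ?T Y) (\<lambda>y. (g, y))"
      using that by (intro continuous_map_pairedI) (simp_all add: topspace_Homeo_plus_circle)
    from continuous_map_compose[OF this cont] show ?thesis by (simp add: o_def)
  qed
  have cont_g: "continuous_map ?T Y (\<lambda>g. \<phi> g y)" if "y \<in> topspace Y" for y
  proof -
    have "continuous_map ?T (prod_topology ?T Y) (\<lambda>g. (g, y))"
      using that by (intro continuous_map_pairedI) simp_all
    from continuous_map_compose[OF this cont] show ?thesis by (simp add: o_def)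
  qed
  \<comment> \<open>SUC with the neighborhood of the identity replaced by a uniform distance
    \<open>r\<close> on the circle.\<close>
  have SUC_nhd: "\<exists>r>0. \<forall>u\<in>?G. (\<forall>z\<in>circle. dist z (u z) < r) \<longrightarrow>
      (\<forall>g\<in>?G. (\<phi> (?mult g u) y, \<phi> g y) \<in> E)"
    if y: "y \<in> topspace Y" and E: "E \<in> the_uniformity Y" for y E
  proof -
    obtain U where U: "openin ?T U" "\<one>\<^bsub>Homeo_plus_circle\<^esub> \<in> U"
      "\<forall>g\<in>?G. \<forall>u\<in>U. (\<phi> (?mult g u) y, \<phi> g y) \<in> E"
      using SUC y E unfolding SUC_G_space_def by metis
    obtain r where r: "r > 0"
      "\<forall>u\<in>?G. (\<forall>z\<in>circle. dist (\<one>\<^bsub>Homeo_plus_circle\<^esub> z) (u z) < r) \<longrightarrow> u \<in> U"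
      using U(1,2) unfolding openin_Homeo_plus_circle_topology by metis
    have "(\<forall>z\<in>circle. dist (\<one>\<^bsub>Homeo_plus_circle\<^esub> z) (u z) < r) \<longleftrightarrow> (\<forall>z\<in>circle. dist z (u z) < r)" for u
      by (rule ball_cong[OF refl]) (simp only: Homeo_plus_circle_one restrict_apply')
    then show ?thesis using r U(3) by metis
  qed

  \<comment> \<open>The candidate fixed point, a cluster point of an orbit pushed towards 1\<close>
  have "\<exists>g\<in>?G. extends_interval (odds_scale (1 / real (Suc n))) g" for n
    by (rule interval_homeo_realization[OF interval_homeo_odds_scale[of "1 / real (Suc n)"]]) auto
  then obtain g where g: "\<And>n. g n \<in> ?G" "\<And>n. extends_interval (odds_scale (1 / real (Suc n))) (g n)"
    by metis
  obtain y0 where y0: "y0 \<in> topspace Y" using Y(1) by blast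
  obtain y where y: "y \<in> topspace Y"
    and cluster: "\<And>A N. openin Y A \<Longrightarrow> y \<in> A \<Longrightarrow> \<exists>n\<ge>N. \<phi> (g n) y0 \<in> A"
    using compact_space_cluster_point[OF Y(2), of "\<lambda>n. \<phi> (g n) y0"] in_Y[OF g(1) y0] by metis

  \<comment> \<open>Homeomorphisms that are the identity on an arc starting at 1\<close>
  have fixed_near: "\<phi> h y = y"
    if h: "h \<in> ?G" "interval_homeo q" "extends_interval q h" "0 < \<eta>" "\<eta> < 1"
      "\<And>x. 0 \<le> x \<Longrightarrow> x \<le> \<eta> \<Longrightarrow> q x = x" for h q \<eta>
  proof (rule ccontr)
    assume "\<phi> h y \<noteq> y"
    then obtain E A B where EAB: "E \<in> the_uniformity Y" "openin Y A" "openin Y B" "\<phi> h y \<in> A" "y \<in> B"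
      "\<And>a b. a \<in> A \<Longrightarrow> b \<in> B \<Longrightarrow> (a, b) \<notin> E"
      using the_uniformity_separates[OF Y(2,3) in_Y[OF h(1) y] y] by metis
    \<comment> \<open>SUC is applied at \<open>y0\<close>, with a bound uniform in the left factor;
      this permits the factor \<open>g n\<close> to be chosen after \<open>r\<close>.\<close>
    obtain r where r: "r > 0" "\<And>u k. u \<in> ?G \<Longrightarrow> \<forall>z\<in>circle. dist z (u z) < r \<Longrightarrow> k \<in> ?G \<Longrightarrow>
        (\<phi> (?mult k u) y0, \<phi> k y0) \<in> E"
      using SUC_nhd[OF y0 EAB(1)] by metis
    have "r * \<eta> / (2 * pi) > 0" using r(1) h(4) by simp
    then obtain N where N: "1 / real (Suc N) < r * \<eta> / (2 * pi)" by (rule nat_approx_posE)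
    \<comment> \<open>One visit of the sequence to this neighborhood of \<open>y\<close> puts a
      point in \<open>B\<close> and its image under \<open>h\<close> in \<open>A\<close>
      simultaneously.\<close>
    define B' where "B' = B \<inter> {z \<in> topspace Y. \<phi> h z \<in> A}"
    have "openin Y B'"
      unfolding B'_def using openin_continuous_map_preimage[OF cont_y[OF h(1)] EAB(2)] EAB(3) by blast
    moreover have "y \<in> B'" using EAB y by (simp add: B'_def)
    ultimately obtain n where n: "n \<ge> N" "\<phi> (g n) y0 \<in> B'" using cluster by blast
    let ?a = "1 / real (Suc n)"
    have "?a \<le> 1 / real (Suc N)" using n(1) by (simp add: divide_simps)
    then have "?a < r * \<eta> / (2 * pi)" using N by linarith
    then have "?a * (2 * pi) < r * \<eta>" by (rule pos_less_divide_eq[THEN iffD1, rotated]) simp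
    then have a: "0 < ?a" "?a * 2 * pi < r * \<eta>" by simp_all
    define u where "u = ?mult (inv\<^bsub>Homeo_plus_circle\<^esub> (g n)) (?mult h (g n))"
    have u: "u \<in> ?G" using g(1) h(1) by (simp add: u_def)
    have "\<forall>z\<in>circle. dist z (u z) < r"
      using extends_interval_odds_scale_conj_close[OF h g(1) g(2) a] unfolding u_def by blast
    then have "(\<phi> (?mult (g n) u) y0, \<phi> (g n) y0) \<in> E" using r(2) u g(1) by blast
    \<comment> \<open>Conjugation makes the small right factor \<open>u\<close> act after
      \<open>g n\<close> as the fixed left factor \<open>h\<close>.\<close>
    moreover have "?mult (g n) u = ?mult h (g n)"
      unfolding u_def using g(1) h(1) by (simp add: m_assoc[symmetric])
    ultimately have "(\<phi> h (\<phi> (g n) y0), \<phi> (g n) y0) \<in> E"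
      using comp[OF h(1) g(1) y0] by simp
    then show False using n(2) EAB(6) unfolding B'_def by blast
  qed

  \<comment> \<open>The whole stabilizer of 1, by density\<close>
  have fixed_stabilizer: "\<phi> h y = y" if h: "h \<in> ?G" "h 1 = 1" for h
  proof (rule ccontr)
    assume neq: "\<phi> h y \<noteq> y"
    have "closedin Y {y}" using Y(3) y by (simp add: closedin_Hausdorff_sing_eq)
    then have "openin Y (topspace Y - {y})" by blast
    \<comment> \<open>The elements that move \<open>y\<close> form an open set. If it contained
      \<open>h\<close>, it would contain a nearby map that is the identity on an arc starting at
      1.\<close>
    define W where "W = {k \<in> ?G. \<phi> k y \<in> topspace Y - {y}}"
    from openin_continuous_map_preimage[OF cont_g[OF y] \<open>openin Y (topspace Y - {y})\<close>]
    have "openin ?T W"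
      unfolding W_def topspace_Homeo_plus_circle .
    moreover have "h \<in> W" using neq h in_Y y by (simp add: W_def)
    ultimately obtain r where r: "r > 0"
      "\<And>k. k \<in> ?G \<Longrightarrow> \<forall>z\<in>circle. dist (h z) (k z) < r \<Longrightarrow> k \<in> W"
      unfolding openin_Homeo_plus_circle_topology by metis
    obtain k q \<eta> where k: "k \<in> ?G" "interval_homeo q" "extends_interval q k" "0 < \<eta>" "\<eta> < 1"
      "\<And>x. 0 \<le> x \<Longrightarrow> x \<le> \<eta> \<Longrightarrow> q x = x" "\<And>z. z \<in> circle \<Longrightarrow> dist (h z) (k z) < r"
      using approx_identity_near_0[OF h r(1)] by metis
    have "\<phi> k y = y" by (rule fixed_near[OF k(1-6)])
    then show False using r(2)[OF k(1)] k(7) unfolding W_def by blast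
  qed

  \<comment> \<open>All of the group, by means of a small rotation\<close>
  have "\<phi> k y = y" if k: "k \<in> ?G" for k
  proof (rule ccontr)
    assume neq: "\<phi> k y \<noteq> y"
    then have k1: "k 1 \<noteq> 1" using fixed_stabilizer k by blast
    obtain E A B where E: "E \<in> the_uniformity Y" "\<phi> k y \<in> A" "y \<in> B"
      "\<And>a b. a \<in> A \<Longrightarrow> b \<in> B \<Longrightarrow> (a, b) \<notin> E"
      using the_uniformity_separates[OF Y(2,3) in_Y[OF k y] y neq] by metis
    obtain r where r: "r > 0" "\<And>u g. u \<in> ?G \<Longrightarrow> \<forall>z\<in>circle. dist z (u z) < r \<Longrightarrow> g \<in> ?G \<Longrightarrow>
        (\<phi> (?mult g u) y, \<phi> g y) \<in> E"
      using SUC_nhd[OF y E(1)] by metis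
    have one: "(1::complex) \<in> circle" by simp
    obtain t where t: "0 \<le> t" "t < 1" "k 1 = circ t"
      using Homeo_plus_circle_props(6)[OF k one] by (rule circ_surj)
    then have t0: "0 < t" using k1 by (cases "t = 0") auto
    \<comment> \<open>The rotation by \<open>c\<close> moves points by at most \<open>r / 2\<close>,
      and \<open>c\<close> stays strictly between 0 and 1.\<close>
    define c where "c = min (1 / 2) (r / (4 * pi))"
    have c: "0 < c" "c < 1" "2 * pi * c < r"
    proof -
      show "0 < c" "c < 1" using r(1) by (auto simp: c_def)
      have "2 * pi * c \<le> 2 * pi * (r / (4 * pi))" unfolding c_def by (intro mult_left_mono) auto
      then show "2 * pi * c < r" using r(1) by simp
    qed
    have "degree_one (\<lambda>x. x + c)" "strict_mono (\<lambda>x. x + c)"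
      by (auto simp: degree_one_def strict_mono_def intro!: continuous_intros)
    then obtain u where u: "u \<in> ?G" "lifts (\<lambda>x. x + c) u" by (rule degree_one_realization)
    have "dist z (u z) < r" if z: "z \<in> circle" for z
    proof -
      obtain x where "z = circ x" using z by (metis circ_surj)
      then show ?thesis using u(2) dist_circ[of x "x + c"] c by (simp add: lifts_def)
    qed
    then have SUCu: "(\<phi> (?mult h u) y, \<phi> h y) \<in> E" if "h \<in> ?G" for h using r(2) u(1) that by blast
    \<comment> \<open>The resulting \<open>h\<close> fixes 1 and carries \<open>u 1\<close>, however
      close to 1, to \<open>k 1\<close>.\<close>
    obtain a where a: "a > 0" "odds_scale a c = t"
      using odds_scale_transitive[OF c(1,2) t0 t(2)] .
    obtain h where h: "h \<in> ?G" "extends_interval (odds_scale a) h"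
      using interval_homeo_realization[OF interval_homeo_odds_scale[OF a(1)]] .
    have "h (circ 0) = circ (odds_scale a 0)" "h (circ c) = circ (odds_scale a c)"
      using h(2)[unfolded extends_interval_def, rule_format, of 0]
        h(2)[unfolded extends_interval_def, rule_format, of c] c by simp_all
    moreover have "odds_scale a 0 = 0" by (simp add: odds_scale_def)
    ultimately have h1: "h 1 = 1" "h (circ c) = k 1" using a(2) t(3) by simp_all
    have u1: "u 1 = circ c" using u(2)[unfolded lifts_def, rule_format, of 0] by simp
    \<comment> \<open>\<open>k\<close> and the product of \<open>h\<close> and \<open>u\<close>
      agree at 1, so they differ by an element of the stabilizer and act alike on
      \<open>y\<close>.\<close>
    define s where "s = ?mult (inv\<^bsub>Homeo_plus_circle\<^esub> k) (?mult h u)"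
    have s: "s \<in> ?G" using h(1) u(1) k by (simp add: s_def)
    have "s 1 = (inv\<^bsub>Homeo_plus_circle\<^esub> k) (h (u 1))"
      using h(1) u(1) k one by (simp only: s_def Homeo_plus_circle_mult_apply m_closed inv_closed)
    also have "\<dots> = 1" using u1 h1(2) Homeo_plus_circle_inv_apply(2)[OF k one] by simp
    finally have "\<phi> s y = y" using fixed_stabilizer s by blast
    moreover have "?mult k s = ?mult h u"
      unfolding s_def using k h(1) u(1) by (simp add: m_assoc[symmetric])
    ultimately have "\<phi> (?mult h u) y = \<phi> k y" using comp[OF k s y] by simp
    \<comment> \<open>SUC at \<open>y\<close> compares the product of \<open>h\<close> and
      \<open>u\<close> with \<open>h\<close>; the former acts on \<open>y\<close> as
      \<open>k\<close>, the latter fixes \<open>y\<close>.\<close>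
    then have "(\<phi> k y, y) \<in> E" using SUCu[OF h(1)] fixed_stabilizer[OF h(1) h1(1)] by simp
    then show False using E(2-4) by blast
  qed
  then show ?thesis unfolding has_fixed_point_def using y by blast
qed

text \<open>The type \<open>'y\<close> is free, so the fixed point property holds for spaces over
  every type; for the failure one type suffices, and \<open>complex\<close> carries the
  circle.\<close>

theorem corollary14p7:
  shows "Polish_group Homeo_plus_circle Homeo_plus_circle_topology \<and>
    SUC_fpp TYPE('y) Homeo_plus_circle Homeo_plus_circle_topology \<and>
    \<not> extremely_amenable TYPE(complex) Homeo_plus_circle Homeo_plus_circle_topology"
  using Polish_group_Homeo_plus_circle SUC_Homeo_plus_circle_fixed_point
    not_extremely_amenable_Homeo_plus_circle
  unfolding SUC_fpp_def by blast

end
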